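(* Let $K\ge 2$, let $\mu_1,\dots,\mu_K\in\mathbb{R}$ be pairwise distinct, let $\sigma_1,\dots,\sigma_K>0$, and suppose that for each $i\in\{1,\dots,K\}$ the samples $X_{i1},X_{i2},\dots$ are i.i.d. $\mathcal{N}(\mu_i,\sigma_i^2)$, with samples independent across different designs $i$. Suppose the initial sample size $N_0\ge 2$ is a constant independent of the total budget $T$. Then: (a) for the algorithm OCBA and for the algorithm OCBA-D, there is a constant $C>0$ independent of $T$ such that $$\mathrm{PFS}(T)\ \ge\ C\,T^{-(K-1)(N_0-1)}\qquad\text{for all integers } T\ge KN_0;$$ (b) for the algorithm OCBA-R, $$-\lim_{T\to\infty}\frac1T\log \mathrm{PFS}(T)=0 .$$
   Context: Setting. The set of designs is $\mathcal{I}=\{1,\dots,K\}$ and $X_{ir}$ is the output of the $r$th simulation run of design $i$. The true best design is $b=\arg\max_{i}\mu_i$. For $n\ge 2$, $\bar X_{i,n}=\frac1n\sum_{r=1}^n X_{ir}$ and $S_{i,n}^2=\frac1{n-1}\sum_{r=1}^n (X_{ir}-\bar X_{i,n})^2$, $S_{i,n}\ge 0$. $N_i(\ell)$ denotes the number of runs of design $i$ available at the beginning of iteration $\ell=0,1,2,\dots$; $\bar X_i(\ell)=\bar X_{i,N_i(\ell)}$, $S_i(\ell)=S_{i,N_i(\ell)}$. Ties (which have probability zero where relevant) are broken by any fixed rule. $\lfloor\cdot\rfloor$ is the floor function. Estimated fractions. With $\hat b=\hat b(\ell)=\arg\max_{i}\bar X_i(\ell)$, let $$\hat\beta_i(\ell)=\frac{S_i^2(\ell)}{[\bar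 X_{\hat b}(\ell)-\bar X_i(\ell)]^2}\ (i\ne\hat b),\qquad \hat\beta_{\hat b}(\ell)=S_{\hat b}(\ell)\sqrt{\sum_{i\neq\hat b}\hat\beta_i^2(\ell)/S_i^2(\ell)},\qquad \hat\alpha_i(\ell)=\frac{\hat\beta_i(\ell)}{\sum_{j\in\mathcal I}\hat\beta_j(\ell)} .$$ All three algorithms take as input $N_0\ge2$ and a total budget $T\ge KN_0$, and start by running $N_0$ replications of each design, so $N_i(0)=N_0$. When they stop, they output $\hat b=\arg\max_i \bar X_i(\ell)$ for the final $\ell$. OCBA (with additional fixed input $\Delta\ge1$): let $T'(\ell)=KN_0+(\ell+1)\Delta$. While $\sum_i N_i(\ell)<T$ and $T'(\ell)\le T$: compute $\hat\alpha_i(\ell)$; for each $i$ run $\max\{0,\lfloor\hat\alpha_i(\ell)T'(\ell)\rfloor-N_i(\ell)\}$ further replications of design $i$, so $N_i(\ell+1)=\max\{N_i(\ell),\lfloor\hat\alpha_i(\ell)T'(\ell)\rfloor\}$; then increase $\ell$ by one. OCBA-D: while $\sum_i N_i(\ell)<T$: compute $\hat\alpha_i(\ell)$; run one replication of design $i^*=\arg\max_i\{\hat\alpha_i(\ell)/N_i(\ell)\}$; set $N_{i^*}(\ell+1)=N_{i^*}(\ell)+1$ and $N_i(\ell+1)=N_i(\ell)$ for $i\ne i^*$; increase $\ell$ by one. OCBA-R: as OCBA-D, except that $i^*=\min\{k\in\{1,\dots,K\}: U(\ell)\le\sum_{i=1}^k\hat\alpha_i(\ell)\}$, where $U(0),U(1),\dots$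 are i.i.d. Uniform$(0,1)$ and independent of all samples. $\mathrm{PFS}(T)$, the probability of false selection, is the probability that the output $\hat b$ of the algorithm run with budget $T$ differs from $b$. *)

theory Defs
  imports "HOL-Probability.Probability"
begin

text \<open>
  A sample path is a function \<open>x\<close> where \<open>x i r\<close> is the output of run \<open>r = 1, 2, \<dots>\<close> of design
  \<open>i \<in> {1..K}\<close>; an allocation \<open>N\<close> gives the number \<open>N i\<close> of runs of design \<open>i\<close> used so far.
  Values at designs outside \<open>{1..K}\<close> are never used.
\<close>

definition sample_mean :: "(nat \<Rightarrow> real) \<Rightarrow> nat \<Rightarrow> real" where
  "sample_mean x n = (\<Sum>r = 1..n. x r) / real n"

definition sample_var :: "(nat \<Rightarrow> real) \<Rightarrow> nat \<Rightarrow> real" where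
  "sample_var x n = (\<Sum>r = 1..n. (x r - sample_mean x n)\<^sup>2) / (real n - 1)"

definition sample_sd :: "(nat \<Rightarrow> real) \<Rightarrow> nat \<Rightarrow> real" where
  "sample_sd x n = sqrt (sample_var x n)"

text \<open>A tie-breaking rule selects one design from every possible set of tied designs.\<close>

definition tie_rule :: "nat \<Rightarrow> (nat set \<Rightarrow> nat) \<Rightarrow> bool" where
  "tie_rule K tie \<longleftrightarrow> (\<forall>A. A \<subseteq> {1..K} \<and> A \<noteq> {} \<longrightarrow> tie A \<in> A)"

definition argmax :: "(nat set \<Rightarrow> nat) \<Rightarrow> nat \<Rightarrow> (nat \<Rightarrow> real) \<Rightarrow> nat" where
  "argmax tie K f = tie {i \<in> {1..K}. \<forall>j \<in> {1..K}. f j \<le> f i}"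

definition best_hat ::
  "(nat set \<Rightarrow> nat) \<Rightarrow> nat \<Rightarrow> (nat \<Rightarrow> nat \<Rightarrow> real) \<Rightarrow> (nat \<Rightarrow> nat) \<Rightarrow> nat" where
  "best_hat tie K x N = argmax tie K (\<lambda>i. sample_mean (x i) (N i))"

text \<open>
  Divisions by zero below (tied sample means, vanishing sample variances) occur only on a null
  event for normal samples; there the convention \<open>a / 0 = 0\<close> applies.
\<close>

definition beta_nonbest ::
  "(nat set \<Rightarrow> nat) \<Rightarrow> nat \<Rightarrow> (nat \<Rightarrow> nat \<Rightarrow> real) \<Rightarrow> (nat \<Rightarrow> nat) \<Rightarrow> nat \<Rightarrow> real" where
  "beta_nonbest tie K x N i =
     (let b = best_hat tie K x N
      in (sample_sd (x i) (N i))\<^sup>2 / (sample_mean (x b) (N b) - sample_mean (x i) (N i))\<^sup>2)"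

definition beta_hat ::
  "(nat set \<Rightarrow> nat) \<Rightarrow> nat \<Rightarrow> (nat \<Rightarrow> nat \<Rightarrow> real) \<Rightarrow> (nat \<Rightarrow> nat) \<Rightarrow> nat \<Rightarrow> real" where
  "beta_hat tie K x N i =
     (let b = best_hat tie K x N
      in if i = b
         then sample_sd (x b) (N b) *
              sqrt (\<Sum>j \<in> {1..K} - {b}. (beta_nonbest tie K x N j)\<^sup>2 / (sample_sd (x j) (N j))\<^sup>2)
         else beta_nonbest tie K x N i)"

definition alpha_hat ::
  "(nat set \<Rightarrow> nat) \<Rightarrow> nat \<Rightarrow> (nat \<Rightarrow> nat \<Rightarrow> real) \<Rightarrow> (nat \<Rightarrow> nat) \<Rightarrow> nat \<Rightarrow> real" where
  "alpha_hat tie K x N i = beta_hat tie K x N i / (\<Sum>j = 1..K. beta_hat tie K x N j)"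

text \<open>
  None of the update rules depends on the total budget \<open>T\<close>, so the allocations are defined for all
  iterations \<open>\<ell>\<close>, and the output is read off at the first \<open>\<ell>\<close> at which the loop condition fails.
\<close>

definition ocba_budget :: "nat \<Rightarrow> nat \<Rightarrow> real \<Rightarrow> nat \<Rightarrow> real" where
  "ocba_budget K N0 \<Delta> l = real (K * N0) + (real l + 1) * \<Delta>"

primrec ocba_alloc ::
  "(nat set \<Rightarrow> nat) \<Rightarrow> nat \<Rightarrow> nat \<Rightarrow> real \<Rightarrow> (nat \<Rightarrow> nat \<Rightarrow> real) \<Rightarrow> nat \<Rightarrow> nat \<Rightarrow> nat" where
  "ocba_alloc tie K N0 \<Delta> x 0 = (\<lambda>i. N0)"
| "ocba_alloc tie K N0 \<Delta> x (Suc l) =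
     (let N = ocba_alloc tie K N0 \<Delta> x l
      in (\<lambda>i. max (N i) (nat \<lfloor>alpha_hat tie K x N i * ocba_budget K N0 \<Delta> l\<rfloor>)))"

definition ocba_output ::
  "(nat set \<Rightarrow> nat) \<Rightarrow> nat \<Rightarrow> nat \<Rightarrow> real \<Rightarrow> nat \<Rightarrow> (nat \<Rightarrow> nat \<Rightarrow> real) \<Rightarrow> nat" where
  "ocba_output tie K N0 \<Delta> T x =
     best_hat tie K x (ocba_alloc tie K N0 \<Delta> x
       (LEAST l. \<not> ((\<Sum>i = 1..K. ocba_alloc tie K N0 \<Delta> x l i) < T \<and> ocba_budget K N0 \<Delta> l \<le> real T)))"

text \<open>
  Fully sequential allocation: in iteration \<open>l\<close>, with current allocation \<open>N\<close>, one further run of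
  design \<open>pick l N\<close> is made.
\<close>

primrec seq_alloc :: "(nat \<Rightarrow> (nat \<Rightarrow> nat) \<Rightarrow> nat) \<Rightarrow> nat \<Rightarrow> nat \<Rightarrow> nat \<Rightarrow> nat" where
  "seq_alloc pick N0 0 = (\<lambda>i. N0)"
| "seq_alloc pick N0 (Suc l) =
     (let N = seq_alloc pick N0 l; k = pick l N in N(k := N k + 1))"

definition seq_output ::
  "(nat set \<Rightarrow> nat) \<Rightarrow> nat \<Rightarrow> nat \<Rightarrow> (nat \<Rightarrow> (nat \<Rightarrow> nat) \<Rightarrow> nat) \<Rightarrow> nat \<Rightarrow> (nat \<Rightarrow> nat \<Rightarrow> real) \<Rightarrow> nat" where
  "seq_output tie K N0 pick T x =
     best_hat tie K x (seq_alloc pick N0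
       (LEAST l. \<not> ((\<Sum>i = 1..K. seq_alloc pick N0 l i) < T)))"

definition ocba_d_choice ::
  "(nat set \<Rightarrow> nat) \<Rightarrow> nat \<Rightarrow> (nat \<Rightarrow> nat \<Rightarrow> real) \<Rightarrow> nat \<Rightarrow> (nat \<Rightarrow> nat) \<Rightarrow> nat" where
  "ocba_d_choice tie K x l N = argmax tie K (\<lambda>i. alpha_hat tie K x N i / real (N i))"

definition ocba_d_output ::
  "(nat set \<Rightarrow> nat) \<Rightarrow> nat \<Rightarrow> nat \<Rightarrow> nat \<Rightarrow> (nat \<Rightarrow> nat \<Rightarrow> real) \<Rightarrow> nat" where
  "ocba_d_output tie K N0 T x = seq_output tie K N0 (ocba_d_choice tie K x) T x"

text \<open>
  For OCBA-R, \<open>u l\<close> is the uniform number drawn in iteration \<open>l\<close>. A suitable \<open>k\<close> exists almost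
  surely; the value of \<open>LEAST\<close> when there is none (degenerate estimates, \<open>u l > 1\<close>) is irrelevant.
\<close>

definition ocba_r_choice ::
  "(nat set \<Rightarrow> nat) \<Rightarrow> nat \<Rightarrow> (nat \<Rightarrow> nat \<Rightarrow> real) \<Rightarrow> (nat \<Rightarrow> real) \<Rightarrow> nat \<Rightarrow> (nat \<Rightarrow> nat) \<Rightarrow> nat" where
  "ocba_r_choice tie K x u l N =
     (LEAST k. k \<in> {1..K} \<and> u l \<le> (\<Sum>i = 1..k. alpha_hat tie K x N i))"

definition ocba_r_output ::
  "(nat set \<Rightarrow> nat) \<Rightarrow> nat \<Rightarrow> nat \<Rightarrow> nat \<Rightarrow> (nat \<Rightarrow> nat \<Rightarrow> real) \<Rightarrow> (nat \<Rightarrow> real) \<Rightarrow> nat" where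
  "ocba_r_output tie K N0 T x u = seq_output tie K N0 (ocba_r_choice tie K x u) T x"

definition true_best :: "nat \<Rightarrow> (nat \<Rightarrow> real) \<Rightarrow> nat" where
  "true_best K \<mu> = arg_max_on \<mu> {1..K}"

text \<open>Probability of false selection for the (random) selected design \<open>out\<close>.\<close>

definition PFS :: "'a measure \<Rightarrow> nat \<Rightarrow> (nat \<Rightarrow> real) \<Rightarrow> ('a \<Rightarrow> nat) \<Rightarrow> real" where
  "PFS M K \<mu> out = measure M {\<omega> \<in> space M. out \<omega> \<noteq> true_best K \<mu>}"

definition PFS_OCBA ::
  "'a measure \<Rightarrow> (nat set \<Rightarrow> nat) \<Rightarrow> nat \<Rightarrow> (nat \<Rightarrow> real) \<Rightarrow> (nat \<Rightarrow> nat \<Rightarrow> 'a \<Rightarrow> real) \<Rightarrow> nat \<Rightarrow> real \<Rightarrow> nat \<Rightarrow> real"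
  where
  "PFS_OCBA M tie K \<mu> X N0 \<Delta> T =
     PFS M K \<mu> (\<lambda>\<omega>. ocba_output tie K N0 \<Delta> T (\<lambda>i r. X i r \<omega>))"

definition PFS_OCBA_D ::
  "'a measure \<Rightarrow> (nat set \<Rightarrow> nat) \<Rightarrow> nat \<Rightarrow> (nat \<Rightarrow> real) \<Rightarrow> (nat \<Rightarrow> nat \<Rightarrow> 'a \<Rightarrow> real) \<Rightarrow> nat \<Rightarrow> nat \<Rightarrow> real"
  where
  "PFS_OCBA_D M tie K \<mu> X N0 T =
     PFS M K \<mu> (\<lambda>\<omega>. ocba_d_output tie K N0 T (\<lambda>i r. X i r \<omega>))"

definition PFS_OCBA_R ::
  "'a measure \<Rightarrow> (nat set \<Rightarrow> nat) \<Rightarrow> nat \<Rightarrow> (nat \<Rightarrow> real) \<Rightarrow> (nat \<Rightarrow> nat \<Rightarrow> 'a \<Rightarrow> real) \<Rightarrow> (nat \<Rightarrow> 'a \<Rightarrow> real)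
     \<Rightarrow> nat \<Rightarrow> nat \<Rightarrow> real"
  where
  "PFS_OCBA_R M tie K \<mu> X U N0 T =
     PFS M K \<mu> (\<lambda>\<omega>. ocba_r_output tie K N0 T (\<lambda>i r. X i r \<omega>) (\<lambda>l. U l \<omega>))"

text \<open>
  \<open>U 0, U 1, \<dots>\<close> are i.i.d. Uniform(0,1) and independent of all samples; given that the samples are
  independent, this is joint independence of the whole family of samples and uniforms.
\<close>

definition uniform_randomization ::
  "'a measure \<Rightarrow> nat \<Rightarrow> (nat \<Rightarrow> nat \<Rightarrow> 'a \<Rightarrow> real) \<Rightarrow> (nat \<Rightarrow> 'a \<Rightarrow> real) \<Rightarrow> bool" where
  "uniform_randomization M K X U \<longleftrightarrow>
     (\<forall>l. distr M lborel (U l) = uniform_measure lborel {0<..<1}) \<and>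
     prob_space.indep_vars M (\<lambda>_. borel) (case_sum (\<lambda>(i, r). X i r) U) (({1..K} \<times> {1..}) <+> UNIV)"

end

theory Submission
  imports Defs
begin

text \<open>
  All three lower bounds come from one event on which the algorithms starve every design but a wrong
  one. Fix a design \<open>j\<close> other than the true best. Suppose that the sample mean of \<open>j\<close> stays above some level
  \<open>A\<close> and its sample standard deviation stays at least some \<open>s > 0\<close> for every number of runs \<open>n \<ge> N0\<close>, while each
  other design \<open>i\<close> starts with a sample mean below \<open>A\<close> and a standard deviation \<open>S i\<close> with
  \<open>0 < S i \<le> \<delta> s\<close>. As long as only \<open>j\<close> has been run, \<open>j\<close> is the apparent best design. With
  \<open>g i\<close> the gap between the sample means of \<open>j\<close> and \<open>i\<close>, the estimated fractions are proportional to
  \<open>(S i)\<^sup>2 / (g i)\<^sup>2\<close> for \<open>i \<noteq> j\<close> and to \<open>S j\<close> times the root of the sum of the squares of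
  \<open>S i / (g i)\<^sup>2\<close> for \<open>j\<close>. Keeping a single summand under the root, the gaps cancel and the fraction of \<open>i\<close>
  is at most \<open>S i / S j \<le> \<delta>\<close> times the fraction of \<open>j\<close>. For \<open>\<delta> = 1 / (4 K T)\<close> this
  is too little for \<open>i\<close> to be run again within the budget \<open>T\<close>: in OCBA the target number of runs rounds down
  to \<open>0\<close>, in OCBA-D the ratio of \<open>i\<close> stays below that of \<open>j\<close>, and in OCBA-R all designs other than \<open>j\<close>
  together own a set of values of the uniform number of length at most \<open>1 / (4 T)\<close>. So \<open>j\<close> is
  selected (the locale \<open>trap\<close>).

  It remains to bound the probability of this event from below. The path of \<open>j\<close> is good with a positive
  probability that does not depend on \<open>T\<close> (lemma \<open>leader_path_positive_prob\<close>), by an exponential Markov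
  inequality and a union bound over \<open>n\<close>. For each other design it suffices that the \<open>N0\<close>
  initial samples are within \<open>O(1 / T)\<close> of each other while their common location ranges over an
  interval of length of order one, which has probability at least a constant times \<open>T\<close> to the power
  \<open>-(N0 - 1)\<close> (lemma \<open>poor_start_prob\<close>). Independence of the designs multiplies \<open>K - 1\<close> such factors. For
  OCBA-R the uniform numbers have to avoid the bad values during the first \<open>T\<close> iterations, which happens
  with probability at least \<open>1 / 2\<close>. Hence its probability of false selection is also at least
  polynomially small, and its exponential rate is zero.

  A lower bound for the probability of false selection by that of a smaller event requires that false
  selection is itself an event; this is the purpose of the locale \<open>measurable_run\<close>.
\<close>

section \<open>Sample paths that mislead all three algorithms\<close>

definition leader_path :: "nat \<Rightarrow> real \<Rightarrow> real \<Rightarrow> (nat \<Rightarrow> real) \<Rightarrow> bool" where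
  "leader_path N0 A s y \<longleftrightarrow> (\<forall>n\<ge>N0. A < sample_mean y n \<and> s \<le> sample_sd y n)"

text \<open>
  The strict lower bound on the standard deviation rules out that \<open>0 / 0 = 0\<close> makes the estimated
  fraction of the leader vanish.
\<close>

definition poor_start :: "nat \<Rightarrow> real \<Rightarrow> real \<Rightarrow> (nat \<Rightarrow> real) \<Rightarrow> bool" where
  "poor_start N0 A e y \<longleftrightarrow> sample_mean y N0 < A \<and> 0 < sample_sd y N0 \<and> sample_sd y N0 \<le> e"

lemma argmax_eqI:
  assumes "tie_rule K tie" "j \<in> {1..K}" "\<And>i. i \<in> {1..K} - {j} \<Longrightarrow> f i < f j"
  shows "argmax tie K f = j"
proof -
  have "{i \<in> {1..K}. \<forall>k \<in> {1..K}. f k \<le> f i} = {j}"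
    using assms(2,3) by (auto; smt (verit) Diff_iff atLeastAtMost_iff singletonD)
  then show ?thesis
    using assms(1,2) unfolding argmax_def tie_rule_def by (metis empty_subsetI insert_subset insert_not_empty singletonD)
qed

lemma maximizers_nonempty:
  fixes f :: "nat \<Rightarrow> real"
  assumes "K \<ge> 1"
  shows "{i \<in> {1..K}. \<forall>j \<in> {1..K}. f j \<le> f i} \<noteq> {}"
proof -
  have "Max (f ` {1..K}) \<in> f ` {1..K}"
    using assms by (intro Max_in) auto
  then obtain i where "i \<in> {1..K}" "f i = Max (f ` {1..K})"
    by auto
  then show ?thesis
    by auto
qed

text \<open>
  Design \<open>j\<close> keeps its mean above \<open>A\<close> for every number of runs, while the others start below \<open>A\<close>; \<open>\<delta>\<close> bounds
  the standard deviations of the others relative to that of \<open>j\<close>.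
\<close>

locale trap =
  fixes tie :: "nat set \<Rightarrow> nat" and K N0 j :: nat and A s \<delta> :: real and x :: "nat \<Rightarrow> nat \<Rightarrow> real"
  assumes tie: "tie_rule K tie"
    and K: "K \<ge> 2"
    and N0: "N0 \<ge> 2"
    and j: "j \<in> {1..K}"
    and s: "s > 0"
    and leader: "leader_path N0 A s (x j)"
    and start: "\<And>i. i \<in> {1..K} - {j} \<Longrightarrow> poor_start N0 A (\<delta> * s) (x i)"
begin

definition only_leader_runs :: "(nat \<Rightarrow> nat) \<Rightarrow> bool" where
  "only_leader_runs N \<longleftrightarrow> N0 \<le> N j \<and> (\<forall>i \<in> {1..K} - {j}. N i = N0)"

lemma other_design: "(if j = 1 then 2 else 1) \<in> {1..K} - {j}"
  using K by auto

lemma delta_pos: "\<delta> > 0"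
proof -
  from start[OF other_design] have "\<delta> * s > 0"
    unfolding poor_start_def by linarith
  then show ?thesis
    using s by (simp add: zero_less_mult_iff)
qed

context
  fixes N :: "nat \<Rightarrow> nat"
  assumes N: "only_leader_runs N"
begin

lemma leader_stats: "A < sample_mean (x j) (N j)" "s \<le> sample_sd (x j) (N j)"
  using leader N unfolding leader_path_def only_leader_runs_def by auto

lemma other_stats:
  assumes "i \<in> {1..K} - {j}"
  shows "sample_mean (x i) (N i) < A" "0 < sample_sd (x i) (N i)" "sample_sd (x i) (N i) \<le> \<delta> * s"
  using start[OF assms] N assms unfolding poor_start_def only_leader_runs_def by auto

lemma best_hat_leader: "best_hat tie K x N = j"
  unfolding best_hat_def
proof (rule argmax_eqI[OF tie j])
  fix i assume "i \<in> {1..K} - {j}"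
  from other_stats(1)[OF this] leader_stats(1)
  show "sample_mean (x i) (N i) < sample_mean (x j) (N j)"
    by linarith
qed

lemma beta_other:
  assumes "i \<in> {1..K} - {j}"
  shows "beta_hat tie K x N i
       = (sample_sd (x i) (N i))\<^sup>2 / (sample_mean (x j) (N j) - sample_mean (x i) (N i))\<^sup>2"
  using assms by (simp add: beta_hat_def beta_nonbest_def best_hat_leader)

lemma beta_other_pos:
  assumes "i \<in> {1..K} - {j}"
  shows "0 < beta_hat tie K x N i"
  unfolding beta_other[OF assms] using other_stats[OF assms] leader_stats
  by (intro divide_pos_pos) auto

text \<open>
  The central estimate. The value of the leader contains the factor \<open>sample_sd\<close> of \<open>j\<close>, which is at least
  \<open>s\<close>, and under the root the square of the value of \<open>i\<close> divided by the standard deviation of \<open>i\<close>. The gap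
  between the two means occurs in the same way on both sides and cancels, which leaves the ratio of the
  standard deviations.
\<close>

lemma beta_other_le:
  assumes i: "i \<in> {1..K} - {j}"
  shows "beta_hat tie K x N i \<le> \<delta> * beta_hat tie K x N j"
proof -
  \<comment> \<open>The value of the leader is its standard deviation times the Euclidean norm of \<open>g\<close>.\<close>
  define g where "g = (\<lambda>k. beta_nonbest tie K x N k / sample_sd (x k) (N k))"
  have gi: "g i > 0" "beta_hat tie K x N i = g i * sample_sd (x i) (N i)"
    using beta_other_pos[OF i] other_stats[OF i] i
    by (auto simp: g_def beta_hat_def best_hat_leader)
  have "g i = sqrt ((g i)\<^sup>2)"
    using gi by simp
  also have "\<dots> \<le> sqrt (\<Sum>k \<in> {1..K} - {j}. (g k)\<^sup>2)"
    using i by (intro real_sqrt_le_mono member_le_sum) auto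
  finally have *: "g i \<le> sqrt (\<Sum>k \<in> {1..K} - {j}. (g k)\<^sup>2)" .
  have "beta_hat tie K x N i \<le> g i * (\<delta> * s)"
    unfolding gi(2) using gi(1) other_stats(3)[OF i] by (intro mult_left_mono) auto
  also have "\<dots> = \<delta> * (s * g i)"
    by simp
  also have "\<dots> \<le> \<delta> * (sample_sd (x j) (N j) * sqrt (\<Sum>k \<in> {1..K} - {j}. (g k)\<^sup>2))"
    using delta_pos s leader_stats * gi(1) by (intro mult_left_mono mult_mono) auto
  also have "\<dots> = \<delta> * beta_hat tie K x N j"
    by (simp add: beta_hat_def best_hat_leader g_def power_divide)
  finally show ?thesis .
qed

lemma beta_pos:
  assumes i: "i \<in> {1..K}"
  shows "0 < beta_hat tie K x N i"
proof (cases "i = j")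
  case True
  have "0 < \<delta> * beta_hat tie K x N j"
    using beta_other_pos[OF other_design] beta_other_le[OF other_design] by linarith
  then show ?thesis
    using delta_pos True by (simp add: zero_less_mult_iff)
qed (use beta_other_pos i in auto)

lemma sum_beta_pos: "0 < (\<Sum>i = 1..K. beta_hat tie K x N i)"
  using beta_pos j by (intro sum_pos) auto

lemma alpha_pos: "i \<in> {1..K} \<Longrightarrow> 0 < alpha_hat tie K x N i"
  unfolding alpha_hat_def using beta_pos sum_beta_pos by simp

lemma sum_alpha: "(\<Sum>i = 1..K. alpha_hat tie K x N i) = 1"
  unfolding alpha_hat_def sum_divide_distrib[symmetric] using sum_beta_pos by simp

lemma alpha_le_1: "i \<in> {1..K} \<Longrightarrow> alpha_hat tie K x N i \<le> 1"
  using member_le_sum[of i "{1..K}" "alpha_hat tie K x N"] alpha_pos sum_alpha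
  by (simp add: less_imp_le)

lemma alpha_other_le:
  assumes i: "i \<in> {1..K} - {j}"
  shows "alpha_hat tie K x N i \<le> \<delta> * alpha_hat tie K x N j"
  unfolding alpha_hat_def using beta_other_le[OF i] sum_beta_pos
  by (simp add: divide_right_mono)

lemma alpha_other_le_delta:
  assumes i: "i \<in> {1..K} - {j}"
  shows "alpha_hat tie K x N i \<le> \<delta>"
proof -
  have "\<delta> * alpha_hat tie K x N j \<le> \<delta> * 1"
    using alpha_le_1[OF j] delta_pos by (intro mult_left_mono) auto
  with alpha_other_le[OF i] show ?thesis
    by linarith
qed

lemma ocba_d_choice_leader:
  assumes "\<delta> * real (N j) < real N0"
  shows "ocba_d_choice tie K x l N = j"
  unfolding ocba_d_choice_def
proof (rule argmax_eqI[OF tie j])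
  fix i assume i: "i \<in> {1..K} - {j}"
  have Nj: "N0 \<le> N j" "N i = N0"
    using N i unfolding only_leader_runs_def by auto
  have "alpha_hat tie K x N i * real (N j) \<le> \<delta> * alpha_hat tie K x N j * real (N j)"
    using alpha_other_le[OF i] by (intro mult_right_mono) auto
  also have "\<dots> = alpha_hat tie K x N j * (\<delta> * real (N j))"
    by simp
  also have "\<dots> < alpha_hat tie K x N j * real N0"
    using assms alpha_pos[OF j] by (intro mult_strict_left_mono) auto
  finally show "alpha_hat tie K x N i / real (N i) < alpha_hat tie K x N j / real (N j)"
    using Nj N0 by (simp add: divide_simps mult.commute)
qed

text \<open>
  The partial sums of the fractions stay below \<open>K \<delta>\<close> before the leader is reached, and by the total
  \<open>1\<close> they are at least \<open>1 - K \<delta>\<close> from the leader on.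
\<close>

lemma ocba_r_choice_leader:
  assumes u: "real K * \<delta> < u l" "u l \<le> 1 - real K * \<delta>"
  shows "ocba_r_choice tie K x u l N = j"
  unfolding ocba_r_choice_def
proof (rule Least_equality)
  have small: "(\<Sum>i \<in> I. alpha_hat tie K x N i) \<le> real K * \<delta>" if "I \<subseteq> {1..K} - {j}" for I
  proof -
    have "(\<Sum>i \<in> I. alpha_hat tie K x N i) \<le> of_nat (card I) * \<delta>"
      using that by (intro sum_bounded_above alpha_other_le_delta) auto
    moreover have "card I \<le> K"
      using card_mono[of "{1..K}" I] that by auto
    ultimately show ?thesis
      using delta_pos by (meson less_eq_real_def mult_right_mono of_nat_le_iff order_trans)
  qed
  have "(\<Sum>i = 1..K. alpha_hat tie K x N i)
      = (\<Sum>i = 1..j. alpha_hat tie K x N i) + (\<Sum>i \<in> {Suc j..K}. alpha_hat tie K x N i)"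
    using j by (subst sum.union_disjoint[symmetric]) (auto intro!: sum.cong)
  with small[of "{Suc j..K}"] sum_alpha u(2)
  show "j \<in> {1..K} \<and> u l \<le> (\<Sum>i = 1..j. alpha_hat tie K x N i)"
    using j by fastforce
next
  fix k assume k: "k \<in> {1..K} \<and> u l \<le> (\<Sum>i = 1..k. alpha_hat tie K x N i)"
  show "j \<le> k"
  proof (rule ccontr)
    assume "\<not> j \<le> k"
    then have "{1..k} \<subseteq> {1..K} - {j}"
      using k by auto
    then have "(\<Sum>i = 1..k. alpha_hat tie K x N i) \<le> of_nat (card {1..k}) * \<delta>"
      by (intro sum_bounded_above alpha_other_le_delta) auto
    also have "\<dots> \<le> real K * \<delta>"
      using k delta_pos by (intro mult_right_mono) auto
    finally show False
      using k u(1) by linarith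
  qed
qed

end

text \<open>
  If the leader is picked in every state in which only the leader has been run, then induction shows that
  no other state is reached before the budget is used up.
\<close>

lemma seq_output_leader:
  assumes T: "K * N0 \<le> T"
    and pick: "\<And>l N. only_leader_runs N \<Longrightarrow> l < T \<Longrightarrow> N j \<le> T \<Longrightarrow> pick l N = j"
  shows "seq_output tie K N0 pick T x = j"
proof -
  define R where "R l = (\<lambda>i. if i = j then N0 + l else N0)" for l
  have R: "only_leader_runs (R l)" for l
    unfolding only_leader_runs_def R_def by auto
  have N0_le: "N0 \<le> K * N0"
    using K by simp
  have alloc: "seq_alloc pick N0 l = R l" if "l \<le> T - K * N0" for l
    using that
  proof (induction l)
    case (Suc l)
    have "N0 + l \<le> T" "l < T"
      using Suc.prems N0_le T by linarith+
    then have "pick l (R l) = j"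
      by (intro pick R) (auto simp: R_def)
    moreover have "seq_alloc pick N0 l = R l"
      using Suc by simp
    ultimately have "seq_alloc pick N0 (Suc l) = (R l)(j := R l j + 1)"
      by (simp add: Let_def)
    then show ?case
      by (auto simp: R_def)
  qed (auto simp: R_def)
  have total: "(\<Sum>i = 1..K. seq_alloc pick N0 l i) = K * N0 + l" if "l \<le> T - K * N0" for l
  proof -
    have "(\<Sum>i = 1..K. R l i) = (\<Sum>i = 1..K. N0 + (if i = j then l else 0))"
      by (rule sum.cong) (auto simp: R_def)
    also have "\<dots> = K * N0 + l"
      using j by (simp add: sum.distrib)
    finally show ?thesis
      using alloc[OF that] by simp
  qed
  have "(LEAST l. \<not> ((\<Sum>i = 1..K. seq_alloc pick N0 l i) < T)) = T - K * N0"
  proof (rule Least_equality)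
    show "\<not> ((\<Sum>i = 1..K. seq_alloc pick N0 (T - K * N0) i) < T)"
      using total[of "T - K * N0"] T by simp
  next
    fix l assume l: "\<not> ((\<Sum>i = 1..K. seq_alloc pick N0 l i) < T)"
    show "T - K * N0 \<le> l"
    proof (rule ccontr)
      assume "\<not> T - K * N0 \<le> l"
      with total[of l] l show False
        by linarith
    qed
  qed
  then show ?thesis
    unfolding seq_output_def using alloc[of "T - K * N0"] best_hat_leader[OF R] by simp
qed

lemma ocba_d_output_leader:
  assumes "K * N0 \<le> T" "\<delta> * real T < 1"
  shows "ocba_d_output tie K N0 T x = j"
  unfolding ocba_d_output_def
proof (rule seq_output_leader[OF assms(1)])
  fix l :: nat and N
  assume N: "only_leader_runs N" "N j \<le> T"
  have "\<delta> * real (N j) \<le> \<delta> * real T"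
    using N(2) delta_pos by simp
  then show "ocba_d_choice tie K x l N = j"
    using assms(2) N0 by (intro ocba_d_choice_leader[OF N(1)]) linarith
qed

lemma ocba_r_output_leader:
  assumes "K * N0 \<le> T" "\<And>l. l < T \<Longrightarrow> real K * \<delta> < u l \<and> u l \<le> 1 - real K * \<delta>"
  shows "ocba_r_output tie K N0 T x u = j"
  unfolding ocba_r_output_def
  using assms(2) by (intro seq_output_leader[OF assms(1)] ocba_r_choice_leader) auto

lemma ocba_output_leader:
  assumes T: "\<delta> * real T < 1" and \<Delta>: "\<Delta> \<ge> 1"
  shows "ocba_output tie K N0 \<Delta> T x = j"
proof -
  define P where "P l \<longleftrightarrow> (\<Sum>i = 1..K. ocba_alloc tie K N0 \<Delta> x l i) < T \<and> ocba_budget K N0 \<Delta> l \<le> real T" for l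
  have alloc: "only_leader_runs (ocba_alloc tie K N0 \<Delta> x l)" if "\<And>m. m < l \<Longrightarrow> P m" for l
    using that
  proof (induction l)
    case (Suc l)
    define N where "N = ocba_alloc tie K N0 \<Delta> x l"
    have N: "only_leader_runs N"
      unfolding N_def using Suc by auto
    have "P l"
      using Suc.prems by simp
    then have budget: "ocba_budget K N0 \<Delta> l \<le> real T"
      by (simp add: P_def)
    have "nat \<lfloor>alpha_hat tie K x N i * ocba_budget K N0 \<Delta> l\<rfloor> = 0" if i: "i \<in> {1..K} - {j}" for i
    proof -
      have "alpha_hat tie K x N i * ocba_budget K N0 \<Delta> l \<le> \<delta> * real T"
        using budget alpha_other_le_delta[OF N i] alpha_pos[OF N, of i] delta_pos i \<Delta>
        by (intro mult_mono) (auto simp: ocba_budget_def)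
      then have "\<lfloor>alpha_hat tie K x N i * ocba_budget K N0 \<Delta> l\<rfloor> \<le> 0"
        using T by linarith
      then show ?thesis
        by simp
    qed
    with N show ?case
      unfolding only_leader_runs_def ocba_alloc.simps Let_def N_def[symmetric]
      by (auto simp del: zero_less_nat_eq nat_eq_iff)
  qed (auto simp: only_leader_runs_def)
  \<comment> \<open>The loop condition fails at the latest in iteration \<open>T\<close>, because the running budget grows by
    \<open>\<Delta> \<ge> 1\<close> each time.\<close>
  have "\<not> P T"
  proof -
    have "real T + 1 \<le> (real T + 1) * \<Delta>"
      using \<Delta> mult_left_mono[of 1 \<Delta> "real T + 1"] by simp
    moreover have "0 \<le> real (K * N0)"
      by simp
    ultimately have "real T < ocba_budget K N0 \<Delta> T"
      unfolding ocba_budget_def by linarith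
    then show ?thesis
      unfolding P_def by linarith
  qed
  have "P m" if "m < (LEAST l. \<not> P l)" for m
    using not_less_Least[OF that] by simp
  then have "only_leader_runs (ocba_alloc tie K N0 \<Delta> x (LEAST l. \<not> P l))"
    by (rule alloc)
  then show ?thesis
    using best_hat_leader unfolding ocba_output_def P_def by simp
qed

end

section \<open>Sample means and variances along a path\<close>

text \<open>
  All samples lie in an interval of length \<open>h\<close>, which bounds the deviations from the mean. The first sample
  is kept in the lower third and the others in the upper third, so that the variance cannot vanish.
\<close>

lemma poor_start_of_box:
  assumes N0: "N0 \<ge> 2" and h: "h > 0" and A: "u + h < A"
    and y1: "u \<le> y 1" "y 1 \<le> u + h / 3"
    and yr: "\<And>r. r \<in> {2..N0} \<Longrightarrow> u + 2 * h / 3 \<le> y r \<and> y r \<le> u + h"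
  shows "poor_start N0 A (2 * h) y"
proof -
  define m where "m = sample_mean y N0"
  define V where "V = (\<Sum>r = 1..N0. (y r - m)\<^sup>2)"
  have y: "u \<le> y r \<and> y r \<le> u + h" if "r \<in> {1..N0}" for r
    using that y1 yr[of r] h by (cases "r = 1") auto
  have "real N0 * u \<le> (\<Sum>r = 1..N0. y r)" "(\<Sum>r = 1..N0. y r) \<le> real N0 * (u + h)"
    using sum_bounded_below[of "{1..N0}" u y] sum_bounded_above[of "{1..N0}" y "u + h"] y by auto
  then have m: "u \<le> m" "m \<le> u + h"
    unfolding m_def sample_mean_def using N0 by (auto simp: field_simps)
  have "(y r - m)\<^sup>2 \<le> h\<^sup>2" if "r \<in> {1..N0}" for r
    using y[OF that] m by (intro abs_le_square_iff[THEN iffD1]) auto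
  then have "V \<le> real N0 * h\<^sup>2"
    unfolding V_def using sum_bounded_above[of "{1..N0}" "\<lambda>r. (y r - m)\<^sup>2" "h\<^sup>2"] by simp
  also have "\<dots> \<le> (2 * h)\<^sup>2 * (real N0 - 1)"
  proof -
    have "real N0 * h\<^sup>2 \<le> (4 * (real N0 - 1)) * h\<^sup>2"
      using N0 by (intro mult_right_mono) auto
    then show ?thesis
      by (simp add: power2_eq_square algebra_simps)
  qed
  finally have V: "V \<le> (2 * h)\<^sup>2 * (real N0 - 1)" .
  have sd: "sample_sd y N0 = sqrt (V / (real N0 - 1))"
    by (simp add: sample_sd_def sample_var_def V_def m_def)
  have "V > 0"
  proof (rule ccontr)
    assume "\<not> V > 0"
    then have "V = 0"
      using sum_nonneg[of "{1..N0}" "\<lambda>r. (y r - m)\<^sup>2"] by (simp add: V_def)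
    then have "y 1 = m" "y 2 = m"
      unfolding V_def using N0 by (auto simp: sum_nonneg_eq_0_iff)
    then show False
      using y1 yr[of 2] h N0 by auto
  qed
  then have "0 < sample_sd y N0"
    unfolding sd using N0 by simp
  moreover have "sample_sd y N0 \<le> 2 * h"
    unfolding sd using V N0 h by (intro real_le_lsqrt) (auto simp: divide_simps)
  ultimately show ?thesis
    using m A unfolding poor_start_def m_def by auto
qed

lemma sum_pairs: "(\<Sum>r = 1..2 * m. g r) = (\<Sum>k = 1..m. g (2 * k - 1) + g (2 * k))"
  for g :: "nat \<Rightarrow> 'a :: comm_monoid_add"
  by (induction m) (auto simp: add.assoc)

text \<open>
  Disjoint pairs of consecutive samples bound the variance from below by an average of independent
  terms, in which the sample mean no longer occurs. Each pair contributes by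
  \<open>(p - q)\<^sup>2 \<le> 2 ((p - a)\<^sup>2 + (q - a)\<^sup>2)\<close>, for any centre \<open>a\<close>.
\<close>

lemma sample_var_ge_pairs:
  assumes "n \<ge> 2"
  defines "m \<equiv> n div 2"
  shows "(\<Sum>k = 1..m. (y (2 * k - 1) - y (2 * k))\<^sup>2) / (4 * real m) \<le> sample_var y n"
proof -
  define a where "a = sample_mean y n"
  have m: "m \<ge> 1" "2 * m \<le> n" "n \<le> 2 * m + 1"
    using assms by auto
  have *: "(p - q)\<^sup>2 / 2 \<le> (p - a)\<^sup>2 + (q - a)\<^sup>2" for p q :: real
  proof -
    have "0 \<le> ((p - a) + (q - a))\<^sup>2"
      by simp
    also have "\<dots> = 2 * ((p - a)\<^sup>2 + (q - a)\<^sup>2) - (p - q)\<^sup>2"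
      by (simp add: power2_eq_square algebra_simps)
    finally show ?thesis
      by simp
  qed
  have "(\<Sum>k = 1..m. (y (2 * k - 1) - y (2 * k))\<^sup>2) / 2 \<le> (\<Sum>k = 1..m. (y (2 * k - 1) - a)\<^sup>2 + (y (2 * k) - a)\<^sup>2)"
    unfolding sum_divide_distrib by (intro sum_mono *)
  also have "\<dots> = (\<Sum>r = 1..2 * m. (y r - a)\<^sup>2)"
    by (rule sum_pairs[symmetric])
  also have "\<dots> \<le> (\<Sum>r = 1..n. (y r - a)\<^sup>2)"
    using m by (intro sum_mono2) auto
  finally have "(\<Sum>k = 1..m. (y (2 * k - 1) - y (2 * k))\<^sup>2) / 2 \<le> (\<Sum>r = 1..n. (y r - a)\<^sup>2)" .
  then have "(\<Sum>k = 1..m. (y (2 * k - 1) - y (2 * k))\<^sup>2) / 2 / (2 * real m)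
      \<le> (\<Sum>r = 1..n. (y r - a)\<^sup>2) / (2 * real m)"
    using m by (intro divide_right_mono) auto
  also have "\<dots> \<le> (\<Sum>r = 1..n. (y r - a)\<^sup>2) / (real n - 1)"
    using m assms by (intro divide_left_mono sum_nonneg) auto
  finally show ?thesis
    by (simp add: sample_var_def a_def)
qed

text \<open>
  Both conditions on the path of the leader follow from linear lower bounds on partial sums of independent
  variables, which is the form that \<open>random_walk_stays_negative\<close> provides.
\<close>

lemma leader_path_of_partial_sums:
  assumes N0: "N0 \<ge> 2" and s: "s \<ge> 0"
    and mean: "\<And>n. n \<ge> 1 \<Longrightarrow> real n * A < (\<Sum>r = 1..n. y r)"
    and pairs: "\<And>m. m \<ge> 1 \<Longrightarrow> real m * (4 * s\<^sup>2) < (\<Sum>k = 1..m. (y (2 * k - 1) - y (2 * k))\<^sup>2)"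
  shows "leader_path N0 A s y"
  unfolding leader_path_def
proof (intro allI impI conjI)
  fix n assume "N0 \<le> n"
  with N0 have n: "n \<ge> 2"
    by simp
  then show "A < sample_mean y n"
    using mean[of n] by (simp add: sample_mean_def field_simps)
  have "s\<^sup>2 \<le> (\<Sum>k = 1..n div 2. (y (2 * k - 1) - y (2 * k))\<^sup>2) / (4 * real (n div 2))"
  proof -
    have "n div 2 \<ge> 1"
      using n by simp
    with pairs[OF this] show ?thesis
      by (simp add: field_simps)
  qed
  also have "\<dots> \<le> sample_var y n"
    by (rule sample_var_ge_pairs[OF n])
  finally show "s \<le> sample_sd y n"
    unfolding sample_sd_def using real_le_rsqrt by blast
qed

section \<open>Measurability of the selected design\<close>

lemma measurable_sample_mean:
  assumes "\<And>r. r \<ge> 1 \<Longrightarrow> (\<lambda>\<omega>. y \<omega> r) \<in> borel_measurable M"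
  shows "(\<lambda>\<omega>. sample_mean (y \<omega>) n) \<in> borel_measurable M"
  unfolding sample_mean_def using assms by (intro borel_measurable_divide borel_measurable_sum) auto

lemma measurable_sample_sd:
  assumes "\<And>r. r \<ge> 1 \<Longrightarrow> (\<lambda>\<omega>. y \<omega> r) \<in> borel_measurable M"
  shows "(\<lambda>\<omega>. sample_sd (y \<omega>) n) \<in> borel_measurable M"
proof -
  have [measurable]: "(\<lambda>\<omega>. \<Sum>r = 1..n. (y \<omega> r - sample_mean (y \<omega>) n)\<^sup>2) \<in> borel_measurable M"
    using assms by (intro borel_measurable_sum borel_measurable_power borel_measurable_diff
        measurable_sample_mean) auto
  show ?thesis
    unfolding sample_sd_def sample_var_def by measurable
qed

lemma pred_leader_path:
  assumes "\<And>r. r \<ge> 1 \<Longrightarrow> (\<lambda>\<omega>. y \<omega> r) \<in> borel_measurable M"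
  shows "Measurable.pred M (\<lambda>\<omega>. leader_path N0 A s (y \<omega>))"
proof -
  note measurable_sample_mean[OF assms, measurable] measurable_sample_sd[OF assms, measurable]
  show ?thesis
    unfolding leader_path_def by measurable
qed

lemma pred_poor_start:
  assumes "\<And>r. r \<ge> 1 \<Longrightarrow> (\<lambda>\<omega>. y \<omega> r) \<in> borel_measurable M"
  shows "Measurable.pred M (\<lambda>\<omega>. poor_start N0 A e (y \<omega>))"
proof -
  note measurable_sample_mean[OF assms, measurable] measurable_sample_sd[OF assms, measurable]
  show ?thesis
    unfolding poor_start_def by measurable
qed

text \<open>
  The set of maximizers takes only finitely many values, so choosing among them by any tie-breaking rule is
  measurable.
\<close>

lemma measurable_argmax:
  assumes tie: "tie_rule K tie" and K: "K \<ge> 1"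
    and f: "\<And>i. i \<in> {1..K} \<Longrightarrow> (\<lambda>\<omega>. f \<omega> i) \<in> borel_measurable M"
  shows "(\<lambda>\<omega>. argmax tie K (f \<omega>)) \<in> M \<rightarrow>\<^sub>M count_space {1..K}"
proof -
  define S where "S \<omega> = {i \<in> {1..K}. \<forall>k \<in> {1..K}. f \<omega> k \<le> f \<omega> i}" for \<omega>
  have S: "S \<omega> \<in> Pow {1..K} - {{}}" for \<omega>
    using maximizers_nonempty[OF K, of "f \<omega>"] by (auto simp: S_def)
  have "S \<in> M \<rightarrow>\<^sub>M count_space (Pow {1..K} - {{}})"
  proof (subst measurable_count_space_eq2, goal_cases)
    case 1
    show ?case
      by simp
  next
    case 2
    have "S \<in> space M \<rightarrow> Pow {1..K} - {{}}"
      using S by (rule funcsetI)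
    moreover have "\<forall>B \<in> Pow {1..K} - {{}}. S -` {B} \<inter> space M \<in> sets M"
    proof
      fix B assume "B \<in> Pow {1..K} - {{}}"
      then have "{i \<in> {1..K}. P i} = B \<longleftrightarrow> (\<forall>i \<in> {1..K}. i \<in> B \<longleftrightarrow> P i)" for P
        by blast
      from this[of "\<lambda>i. \<forall>k \<in> {1..K}. f \<omega> k \<le> f \<omega> i" for \<omega>]
      have S_eq: "S \<omega> = B \<longleftrightarrow> (\<forall>i \<in> {1..K}. i \<in> B \<longleftrightarrow> (\<forall>k \<in> {1..K}. f \<omega> k \<le> f \<omega> i))" for \<omega>
        unfolding S_def .
      have "S -` {B} \<inter> space M = {\<omega> \<in> space M. S \<omega> = B}"
        by auto
      also have "\<dots> = {\<omega> \<in> space M. \<forall>i \<in> {1..K}. i \<in> B \<longleftrightarrow> (\<forall>k \<in> {1..K}. f \<omega> k \<le> f \<omega> i)}"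
        unfolding S_eq ..
      also have "\<dots> \<in> sets M"
      proof -
        have [measurable]: "Measurable.pred M (\<lambda>\<omega>. f \<omega> k \<le> f \<omega> i)" if "k \<in> {1..K}" "i \<in> {1..K}" for i k
          using f[OF that(1)] f[OF that(2)] by measurable
        show ?thesis
          by measurable
      qed
      finally show "S -` {B} \<inter> space M \<in> sets M" .
    qed
    ultimately show ?case
      by blast
  qed
  moreover have "tie \<in> count_space (Pow {1..K} - {{}}) \<rightarrow>\<^sub>M count_space {1..K}"
  proof -
    have "tie B \<in> {1..K}" if "B \<subseteq> {1..K}" "B \<noteq> {}" for B
      using tie that unfolding tie_rule_def by (simp add: subset_iff)
    then show ?thesis
      by (simp add: measurable_count_space_eq1)
  qed
  ultimately have "(\<lambda>\<omega>. tie (S \<omega>)) \<in> M \<rightarrow>\<^sub>M count_space {1..K}"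
    by (rule measurable_compose)
  then show ?thesis
    by (simp add: argmax_def S_def)
qed

locale measurable_run =
  fixes M :: "'a measure" and tie :: "nat set \<Rightarrow> nat" and K :: nat
    and x :: "'a \<Rightarrow> nat \<Rightarrow> nat \<Rightarrow> real"
  assumes tie: "tie_rule K tie" and K: "K \<ge> 1"
    and x: "\<And>i r. i \<in> {1..K} \<Longrightarrow> r \<ge> 1 \<Longrightarrow> (\<lambda>\<omega>. x \<omega> i r) \<in> borel_measurable M"
begin

definition measurable_alloc :: "('a \<Rightarrow> nat \<Rightarrow> nat) \<Rightarrow> bool" where
  "measurable_alloc N \<longleftrightarrow> (\<forall>i \<in> {1..K}. (\<lambda>\<omega>. N \<omega> i) \<in> M \<rightarrow>\<^sub>M count_space UNIV)"

context
  fixes N :: "'a \<Rightarrow> nat \<Rightarrow> nat"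
  assumes N: "measurable_alloc N"
begin

lemma N_measurable: "i \<in> {1..K} \<Longrightarrow> (\<lambda>\<omega>. N \<omega> i) \<in> M \<rightarrow>\<^sub>M count_space UNIV"
  using N unfolding measurable_alloc_def by blast

lemma mean_measurable:
  assumes "i \<in> {1..K}"
  shows "(\<lambda>\<omega>. sample_mean (x \<omega> i) (N \<omega> i)) \<in> borel_measurable M"
  by (rule measurable_compose_countable[OF measurable_sample_mean N_measurable]) (use x assms in auto)

lemma sd_measurable:
  assumes "i \<in> {1..K}"
  shows "(\<lambda>\<omega>. sample_sd (x \<omega> i) (N \<omega> i)) \<in> borel_measurable M"
  by (rule measurable_compose_countable[OF measurable_sample_sd N_measurable]) (use x assms in auto)

lemma best_hat_measurable:
  "(\<lambda>\<omega>. best_hat tie K (x \<omega>) (N \<omega>)) \<in> M \<rightarrow>\<^sub>M count_space {1..K}"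
  unfolding best_hat_def by (intro measurable_argmax tie K mean_measurable)

lemma beta_nonbest_measurable:
  assumes i: "i \<in> {1..K}"
  shows "(\<lambda>\<omega>. beta_nonbest tie K (x \<omega>) (N \<omega>) i) \<in> borel_measurable M"
  unfolding beta_nonbest_def Let_def
  by (rule measurable_compose_countable'[OF _ best_hat_measurable])
     (intro borel_measurable_divide borel_measurable_power borel_measurable_diff
        sd_measurable mean_measurable i, auto)

lemma beta_hat_measurable:
  assumes i: "i \<in> {1..K}"
  shows "(\<lambda>\<omega>. beta_hat tie K (x \<omega>) (N \<omega>) i) \<in> borel_measurable M"
  unfolding beta_hat_def Let_def
proof (rule measurable_compose_countable'[OF _ best_hat_measurable])
  fix b assume b: "b \<in> {1..K}"
  have [measurable]: "(\<lambda>\<omega>. beta_nonbest tie K (x \<omega>) (N \<omega>) k) \<in> borel_measurable M"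
    "(\<lambda>\<omega>. sample_sd (x \<omega> k) (N \<omega> k)) \<in> borel_measurable M" if "k \<in> {1..K}" for k
    using that by (auto intro: beta_nonbest_measurable sd_measurable)
  have [measurable]: "(\<lambda>\<omega>. \<Sum>k \<in> {1..K} - {b}. (beta_nonbest tie K (x \<omega>) (N \<omega>) k)\<^sup>2 /
      (sample_sd (x \<omega> k) (N \<omega> k))\<^sup>2) \<in> borel_measurable M"
    by (intro borel_measurable_sum borel_measurable_divide borel_measurable_power
          beta_nonbest_measurable sd_measurable) auto
  show "(\<lambda>\<omega>. if i = b
      then sample_sd (x \<omega> b) (N \<omega> b) * sqrt (\<Sum>k \<in> {1..K} - {b}.
        (beta_nonbest tie K (x \<omega>) (N \<omega>) k)\<^sup>2 / (sample_sd (x \<omega> k) (N \<omega> k))\<^sup>2)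
      else beta_nonbest tie K (x \<omega>) (N \<omega>) i) \<in> borel_measurable M"
    using i b by (cases "i = b"; simp)
qed auto

lemma alpha_hat_measurable:
  assumes i: "i \<in> {1..K}"
  shows "(\<lambda>\<omega>. alpha_hat tie K (x \<omega>) (N \<omega>) i) \<in> borel_measurable M"
  unfolding alpha_hat_def using i
  by (intro borel_measurable_divide borel_measurable_sum beta_hat_measurable) auto

lemma ocba_d_choice_measurable:
  "(\<lambda>\<omega>. ocba_d_choice tie K (x \<omega>) l (N \<omega>)) \<in> M \<rightarrow>\<^sub>M count_space UNIV"
proof -
  have "(\<lambda>\<omega>. ocba_d_choice tie K (x \<omega>) l (N \<omega>)) \<in> M \<rightarrow>\<^sub>M count_space {1..K}"
    unfolding ocba_d_choice_def
    by (intro measurable_argmax tie K borel_measurable_divide alpha_hat_measurable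
          measurable_compose[OF N_measurable]) auto
  then show ?thesis
    by (rule measurable_compose) simp
qed

lemma ocba_r_choice_measurable:
  assumes "(\<lambda>\<omega>. u \<omega> l) \<in> borel_measurable M"
  shows "(\<lambda>\<omega>. ocba_r_choice tie K (x \<omega>) (u \<omega>) l (N \<omega>)) \<in> M \<rightarrow>\<^sub>M count_space UNIV"
  unfolding ocba_r_choice_def
proof (rule measurable_Least)
  fix k
  show "Measurable.pred M (\<lambda>\<omega>. k \<in> {1..K} \<and> u \<omega> l \<le> (\<Sum>i = 1..k. alpha_hat tie K (x \<omega>) (N \<omega>) i))"
  proof (cases "k \<in> {1..K}")
    case True
    then have [measurable]: "(\<lambda>\<omega>. \<Sum>i = 1..k. alpha_hat tie K (x \<omega>) (N \<omega>) i) \<in> borel_measurable M"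
      by (intro borel_measurable_sum alpha_hat_measurable) auto
    note assms[measurable]
    show ?thesis
      by measurable
  qed (simp only: simp_thms, measurable)
qed

end

lemma measurable_alloc_seq:
  assumes "\<And>l N. measurable_alloc N \<Longrightarrow> (\<lambda>\<omega>. pick \<omega> l (N \<omega>)) \<in> M \<rightarrow>\<^sub>M count_space UNIV"
  shows "measurable_alloc (\<lambda>\<omega>. seq_alloc (pick \<omega>) N0 l)"
proof (induction l)
  case (Suc l)
  show ?case
    unfolding measurable_alloc_def
  proof
    fix i assume "i \<in> {1..K}"
    note old = N_measurable[OF Suc this]
    have "Measurable.pred M (\<lambda>\<omega>. i = pick \<omega> l (seq_alloc (pick \<omega>) N0 l))"
      by (rule measurable_compose[OF assms[OF Suc], of "\<lambda>k. i = k"]) simp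
    moreover have "(\<lambda>\<omega>. seq_alloc (pick \<omega>) N0 l i + 1) \<in> M \<rightarrow>\<^sub>M count_space UNIV"
      by (rule measurable_compose[OF old, of "\<lambda>n. n + 1"]) simp
    ultimately have "(\<lambda>\<omega>. if i = pick \<omega> l (seq_alloc (pick \<omega>) N0 l) then seq_alloc (pick \<omega>) N0 l i + 1
        else seq_alloc (pick \<omega>) N0 l i) \<in> M \<rightarrow>\<^sub>M count_space UNIV"
      using old by (intro measurable_If) auto
    then show "(\<lambda>\<omega>. seq_alloc (pick \<omega>) N0 (Suc l) i) \<in> M \<rightarrow>\<^sub>M count_space UNIV"
      by (rule measurable_cong[THEN iffD1, rotated]) (auto simp: Let_def)
  qed
qed (simp add: measurable_alloc_def)

lemma measurable_alloc_ocba: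
  "measurable_alloc (\<lambda>\<omega>. ocba_alloc tie K N0 \<Delta> (x \<omega>) l)"
proof (induction l)
  case (Suc l)
  show ?case
    unfolding measurable_alloc_def
  proof
    fix i assume "i \<in> {1..K}"
    note [measurable] = N_measurable[OF Suc this] alpha_hat_measurable[OF Suc this]
    show "(\<lambda>\<omega>. ocba_alloc tie K N0 \<Delta> (x \<omega>) (Suc l) i) \<in> M \<rightarrow>\<^sub>M count_space UNIV"
      by (simp add: Let_def) measurable
  qed
qed (simp add: measurable_alloc_def)

lemma pred_total:
  assumes "measurable_alloc N"
  shows "Measurable.pred M (\<lambda>\<omega>. (\<Sum>i = 1..K. N \<omega> i) < (T :: nat))"
proof -
  have "(\<lambda>\<omega>. \<Sum>i = 1..K. real (N \<omega> i)) \<in> borel_measurable M"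
    by (intro borel_measurable_sum measurable_compose[OF N_measurable[OF assms]]) auto
  then have "Measurable.pred M (\<lambda>\<omega>. (\<Sum>i = 1..K. real (N \<omega> i)) < real T)"
    by measurable
  then show ?thesis
    unfolding of_nat_sum[symmetric] of_nat_less_iff .
qed

lemma measurable_stopped_best:
  fixes L :: "'a \<Rightarrow> nat"
  assumes N: "\<And>l. measurable_alloc (\<lambda>\<omega>. N \<omega> l)"
    and L: "L \<in> M \<rightarrow>\<^sub>M count_space UNIV"
  shows "(\<lambda>\<omega>. best_hat tie K (x \<omega>) (N \<omega> (L \<omega>))) \<in> M \<rightarrow>\<^sub>M count_space UNIV"
proof (rule measurable_compose_countable[OF _ L])
  fix l
  show "(\<lambda>\<omega>. best_hat tie K (x \<omega>) (N \<omega> l)) \<in> M \<rightarrow>\<^sub>M count_space UNIV"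
    by (rule measurable_compose[OF best_hat_measurable[OF N]]) simp
qed

lemma seq_output_measurable:
  assumes "\<And>l N. measurable_alloc N \<Longrightarrow> (\<lambda>\<omega>. pick \<omega> l (N \<omega>)) \<in> M \<rightarrow>\<^sub>M count_space UNIV"
  shows "(\<lambda>\<omega>. seq_output tie K N0 (pick \<omega>) T (x \<omega>)) \<in> M \<rightarrow>\<^sub>M count_space UNIV"
  unfolding seq_output_def
  by (intro measurable_stopped_best measurable_alloc_seq measurable_Least pred_intros_logic
        pred_total assms)

lemma ocba_output_measurable:
  "(\<lambda>\<omega>. ocba_output tie K N0 \<Delta> T (x \<omega>)) \<in> M \<rightarrow>\<^sub>M count_space UNIV"
  unfolding ocba_output_def
  by (intro measurable_stopped_best measurable_alloc_ocba measurable_Least pred_intros_logic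
        pred_total) auto

lemma ocba_d_output_measurable:
  "(\<lambda>\<omega>. ocba_d_output tie K N0 T (x \<omega>)) \<in> M \<rightarrow>\<^sub>M count_space UNIV"
  unfolding ocba_d_output_def by (intro seq_output_measurable ocba_d_choice_measurable)

lemma ocba_r_output_measurable:
  assumes "\<And>l. (\<lambda>\<omega>. u \<omega> l) \<in> borel_measurable M"
  shows "(\<lambda>\<omega>. ocba_r_output tie K N0 T (x \<omega>) (u \<omega>)) \<in> M \<rightarrow>\<^sub>M count_space UNIV"
  unfolding ocba_r_output_def by (intro seq_output_measurable ocba_r_choice_measurable assms)

end

section \<open>Independence of blocks of variables\<close>

text \<open>
  The events that are determined by the variables \<open>Z i\<close> with \<open>i \<in> B\<close>, as a measurable space, so that
  membership of an event can be proved by measurability of the variables.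
\<close>

definition block_algebra :: "'a measure \<Rightarrow> ('i \<Rightarrow> 'a \<Rightarrow> real) \<Rightarrow> 'i set \<Rightarrow> 'a measure" where
  "block_algebra M Z B = sigma (space M) (\<Union>i \<in> B. {Z i -` A \<inter> space M | A. A \<in> sets borel})"

lemma space_block_algebra [simp]: "space (block_algebra M Z B) = space M"
  unfolding block_algebra_def by (rule space_measure_of) auto

lemma sets_block_algebra:
  "sets (block_algebra M Z B) = sigma_sets (space M) (\<Union>i \<in> B. {Z i -` A \<inter> space M | A. A \<in> sets borel})"
  unfolding block_algebra_def by (rule sets_measure_of) auto

lemma measurable_block_algebra:
  assumes "i \<in> B"
  shows "Z i \<in> borel_measurable (block_algebra M Z B)"
proof (rule measurableI)
  fix A :: "real set" assume "A \<in> sets borel"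
  then show "Z i -` A \<inter> space (block_algebra M Z B) \<in> sets (block_algebra M Z B)"
    unfolding sets_block_algebra space_block_algebra using assms by (intro sigma_sets.Basic) blast
qed simp

context prob_space
begin

lemma sets_block_algebra_le:
  assumes "indep_vars (\<lambda>_. borel) Z I" "B \<subseteq> I"
  shows "sets (block_algebra M Z B) \<subseteq> events"
  unfolding sets_block_algebra
proof (rule sets.sigma_sets_subset, safe)
  fix i and A :: "real set" assume "i \<in> B" "A \<in> sets borel"
  with assms show "Z i -` A \<inter> space M \<in> events"
    unfolding indep_vars_def2 by (intro measurable_sets[of "Z i" M borel]) auto
qed

lemma indep_block_algebras:
  assumes indep: "indep_vars (\<lambda>_. borel) Z I"
    and disj: "disjoint_family_on B J" and B: "\<And>j. j \<in> J \<Longrightarrow> B j \<subseteq> I"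
  shows "indep_sets (\<lambda>j. sets (block_algebra M Z (B j))) J"
  unfolding sets_block_algebra
proof (rule indep_sets_collect_sigma[OF _ _ disj])
  have "indep_sets (\<lambda>i. {Z i -` A \<inter> space M | A. A \<in> sets borel}) I"
    using indep unfolding indep_vars_def2 by simp
  then show "indep_sets (\<lambda>i. {Z i -` A \<inter> space M | A. A \<in> sets borel}) (\<Union>j \<in> J. B j)"
    by (rule indep_sets_mono_index[rotated]) (use B in blast)
next
  fix i
  show "Int_stable {Z i -` A \<inter> space M | A. A \<in> sets borel}"
  proof (rule Int_stableI, clarify)
    fix A A' :: "real set" assume "A \<in> sets borel" "A' \<in> sets borel"
    then show "\<exists>A''. (Z i -` A \<inter> space M) \<inter> (Z i -` A' \<inter> space M) = Z i -` A'' \<inter> space M \<and> A'' \<in> sets borel"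
      by (intro exI[of _ "A \<inter> A'"]) auto
  qed
qed

lemma indep_vars_of_blocks:
  fixes Y :: "'j \<Rightarrow> 'a \<Rightarrow> real"
  assumes indep: "indep_vars (\<lambda>_. borel) Z I"
    and disj: "disjoint_family_on B J" and B: "\<And>j. j \<in> J \<Longrightarrow> B j \<subseteq> I"
    and Y: "\<And>j. j \<in> J \<Longrightarrow> Y j \<in> block_algebra M Z (B j) \<rightarrow>\<^sub>M borel"
  shows "indep_vars (\<lambda>_. borel) Y J"
  unfolding indep_vars_def2
proof (intro conjI ballI)
  fix j assume j: "j \<in> J"
  show "random_variable borel (Y j)"
  proof (rule measurableI)
    fix A :: "real set" assume "A \<in> sets borel"
    then show "Y j -` A \<inter> space M \<in> events"
      using measurable_sets[OF Y[OF j]] sets_block_algebra_le[OF indep B[OF j]] by auto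
  qed (use measurable_space[OF Y[OF j]] in auto)
next
  show "indep_sets (\<lambda>j. {Y j -` A \<inter> space M | A. A \<in> sets borel}) J"
    using measurable_sets[OF Y] by (intro indep_sets_mono_sets[OF indep_block_algebras[OF indep disj B]]) auto
qed

lemma prob_blocks:
  assumes indep: "indep_vars (\<lambda>_. borel) Z I"
    and disj: "disjoint_family_on B J" and B: "\<And>j. j \<in> J \<Longrightarrow> B j \<subseteq> I"
    and J: "finite J" "J \<noteq> {}"
    and A: "\<And>j. j \<in> J \<Longrightarrow> A j \<in> sets (block_algebra M Z (B j))"
  shows "prob (\<Inter>j \<in> J. A j) = (\<Prod>j \<in> J. prob (A j))"
  using A J by (intro indep_setsD[OF indep_block_algebras[OF indep disj B]]) auto

lemma prob_two_blocks:
  assumes indep: "indep_vars (\<lambda>_. borel) Z I"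
    and B: "B1 \<subseteq> I" "B2 \<subseteq> I" "B1 \<inter> B2 = {}"
    and A: "A1 \<in> sets (block_algebra M Z B1)" "A2 \<in> sets (block_algebra M Z B2)"
  shows "prob (A1 \<inter> A2) = prob A1 * prob A2"
proof -
  have "prob (\<Inter>k \<in> UNIV. case_bool A1 A2 k) = (\<Prod>k \<in> UNIV. prob (case_bool A1 A2 k))"
  proof (rule prob_blocks[OF indep])
    show "disjoint_family_on (case_bool B1 B2) UNIV"
      using B(3) unfolding disjoint_family_on_def UNIV_bool by auto
    show "case_bool B1 B2 k \<subseteq> I" for k
      using B by (cases k) simp_all
    show "case_bool A1 A2 k \<in> sets (block_algebra M Z (case_bool B1 B2 k))" for k
      using A by (cases k) simp_all
  qed simp_all
  then show ?thesis
    by (simp add: UNIV_bool Int_commute mult.commute)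
qed

end

section \<open>A design that stays in the lead\<close>

text \<open>
  By Markov's inequality and independence the exponential of the \<open>n\<close>th partial sum is at least \<open>1\<close> with
  probability at most \<open>10\<close> to the power \<open>-n\<close>, and these bounds add up to \<open>1 / 9\<close>. This serves in
  place of the strong law of large numbers to keep averages away from a level with positive probability for
  all \<open>n\<close> at once: the exponential moments become small when the level is chosen low enough.
\<close>

lemma (in prob_space) random_walk_stays_negative:
  fixes W :: "nat \<Rightarrow> 'a \<Rightarrow> real"
  assumes indep: "indep_vars (\<lambda>_. borel) W {1..}"
    and exp_moment: "\<And>k. k \<ge> 1 \<Longrightarrow> (\<integral>\<^sup>+\<omega>. ennreal (exp (W k \<omega>)) \<partial>M) \<le> ennreal (1 / 10)"
  shows "{\<omega> \<in> space M. \<exists>n\<ge>1. 0 \<le> (\<Sum>k = 1..n. W k \<omega>)} \<in> events"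
    and "prob {\<omega> \<in> space M. \<exists>n\<ge>1. 0 \<le> (\<Sum>k = 1..n. W k \<omega>)} \<le> 1 / 9"
proof -
  have W: "random_variable borel (W k)" if "k \<ge> 1" for k
    using indep that unfolding indep_vars_def2 by auto
  define B where "B n = {\<omega> \<in> space M. 0 \<le> (\<Sum>k = 1..Suc n. W k \<omega>)}" for n
  have S [measurable]: "(\<lambda>\<omega>. \<Sum>k = 1..n. W k \<omega>) \<in> borel_measurable M" for n
    using W by (intro borel_measurable_sum) auto
  have B: "B n \<in> events" for n
    unfolding B_def by measurable
  have UN: "{\<omega> \<in> space M. \<exists>n\<ge>1. 0 \<le> (\<Sum>k = 1..n. W k \<omega>)} = (\<Union>n. B n)"
  proof -
    have "(\<exists>n\<ge>1. P n) \<longleftrightarrow> (\<exists>n. P (Suc n))" for P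
      by (auto simp: Suc_le_eq gr0_conv_Suc)
    note this[of "\<lambda>n. 0 \<le> (\<Sum>k = 1..n. W k \<omega>)" for \<omega>]
    then show ?thesis
      unfolding B_def by (auto simp del: sum.cl_ivl_Suc)
  qed
  have prob_B: "prob (B n) \<le> (1 / 10) ^ Suc n" for n
  proof -
    let ?I = "{1..Suc n}"
    have "emeasure M (B n) = emeasure M {\<omega> \<in> space M. 1 \<le> 1 * (\<Prod>k \<in> ?I. ennreal (exp (W k \<omega>)))}"
      unfolding B_def by (simp add: prod_ennreal exp_sum[symmetric] del: prod.cl_ivl_Suc sum.cl_ivl_Suc)
    also have "\<dots> \<le> 1 * (\<integral>\<^sup>+\<omega>. (\<Prod>k \<in> ?I. ennreal (exp (W k \<omega>))) * indicator (space M) \<omega> \<partial>M)"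
      using W by (intro nn_integral_Markov_inequality) (auto intro!: borel_measurable_times_ennreal borel_measurable_prod_ennreal)
    also have "\<dots> = (\<integral>\<^sup>+\<omega>. (\<Prod>k \<in> ?I. ennreal (exp (W k \<omega>))) \<partial>M)"
      by (auto intro!: nn_integral_cong)
    also have "\<dots> = (\<Prod>k \<in> ?I. \<integral>\<^sup>+\<omega>. ennreal (exp (W k \<omega>)) \<partial>M)"
      by (intro indep_vars_nn_integral indep_vars_compose2[OF indep_vars_subset[OF indep]]) auto
    also have "\<dots> \<le> (\<Prod>k \<in> ?I. ennreal (1 / 10))"
      using exp_moment by (intro prod_mono_ennreal) auto
    also have "\<dots> = ennreal ((1 / 10) ^ Suc n)"
      by (simp only: prod_constant card_atLeastAtMost ennreal_power) simp
    finally have "emeasure M (B n) \<le> ennreal ((1 / 10) ^ Suc n)" .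
    then show ?thesis
      unfolding measure_def by (rule enn2real_leI[rotated]) simp
  qed
  have geo: "(\<lambda>n. (1 / 10 :: real) ^ Suc n) sums (1 / 9)"
    using sums_mult[OF geometric_sums[of "1 / 10 :: real"], of "1 / 10"] by simp
  have sum_B: "summable (\<lambda>n. prob (B n))"
    by (rule summable_comparison_test'[OF sums_summable[OF geo]]) (use prob_B in auto)
  show "{\<omega> \<in> space M. \<exists>n\<ge>1. 0 \<le> (\<Sum>k = 1..n. W k \<omega>)} \<in> events"
    unfolding UN using B by auto
  have "prob (\<Union>n. B n) \<le> (\<Sum>n. prob (B n))"
    using B sum_B by (intro finite_measure_subadditive_countably) auto
  also have "\<dots> \<le> 1 / 9"
    using suminf_le[OF prob_B sum_B sums_summable[OF geo]] sums_unique[OF geo] by simp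
  finally show "prob {\<omega> \<in> space M. \<exists>n\<ge>1. 0 \<le> (\<Sum>k = 1..n. W k \<omega>)} \<le> 1 / 9"
    unfolding UN .
qed

lemma nn_integral_normal_density:
  "\<sigma> > 0 \<Longrightarrow> (\<integral>\<^sup>+x. ennreal (normal_density \<mu> \<sigma> x) \<partial>lborel) = 1"
  by (subst nn_integral_eq_integral) auto

text \<open>
  Completing the square turns the integrand into a multiple of the normal density with mean
  \<open>\<mu> - \<sigma>\<^sup>2\<close>.
\<close>

lemma nn_integral_exp_minus_normal:
  assumes Y: "distributed M lborel Y (normal_density \<mu> \<sigma>)" and \<sigma>: "\<sigma> > 0"
  shows "(\<integral>\<^sup>+\<omega>. ennreal (exp (c - Y \<omega>)) \<partial>M) = ennreal (exp (c - \<mu> + \<sigma>\<^sup>2 / 2))"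
proof -
  have *: "normal_density \<mu> \<sigma> y * exp (c - y) = exp (c - \<mu> + \<sigma>\<^sup>2 / 2) * normal_density (\<mu> - \<sigma>\<^sup>2) \<sigma> y" for y
  proof -
    have "- (y - \<mu>)\<^sup>2 / (2 * \<sigma>\<^sup>2) + (c - y) = (c - \<mu> + \<sigma>\<^sup>2 / 2) + - (y - (\<mu> - \<sigma>\<^sup>2))\<^sup>2 / (2 * \<sigma>\<^sup>2)"
      using \<sigma> by (simp add: field_simps power2_eq_square)
    from arg_cong[OF this, of exp] show ?thesis
      unfolding normal_density_def exp_add by simp
  qed
  have "(\<integral>\<^sup>+\<omega>. ennreal (exp (c - Y \<omega>)) \<partial>M)
      = (\<integral>\<^sup>+y. ennreal (normal_density \<mu> \<sigma> y) * ennreal (exp (c - y)) \<partial>lborel)"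
    by (rule distributed_nn_integral[OF Y, symmetric]) measurable
  also have "\<dots> = (\<integral>\<^sup>+y. ennreal (exp (c - \<mu> + \<sigma>\<^sup>2 / 2)) * ennreal (normal_density (\<mu> - \<sigma>\<^sup>2) \<sigma> y) \<partial>lborel)"
    by (simp add: ennreal_mult[symmetric] *)
  also have "\<dots> = ennreal (exp (c - \<mu> + \<sigma>\<^sup>2 / 2))"
    using \<sigma> by (simp add: nn_integral_cmult nn_integral_normal_density)
  finally show ?thesis .
qed

text \<open>
  The normal density is at most its value at the mean, and what remains is a Gaussian integral. The bound
  tends to \<open>0\<close> as \<open>l\<close> grows.
\<close>

lemma nn_integral_exp_minus_square_normal:
  assumes D: "distributed M lborel D (normal_density 0 \<tau>)" and \<tau>: "\<tau> > 0" and l: "l > 0"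
  shows "(\<integral>\<^sup>+\<omega>. ennreal (exp (c - l * (D \<omega>)\<^sup>2)) \<partial>M) \<le> ennreal (exp c / (\<tau> * sqrt (2 * l)))"
proof -
  have *: "normal_density 0 \<tau> y * exp (c - l * y\<^sup>2)
      \<le> exp c / (\<tau> * sqrt (2 * l)) * normal_density 0 (1 / sqrt (2 * l)) y" for y
  proof -
    have "normal_density 0 \<tau> y \<le> 1 / (\<tau> * sqrt (2 * pi))"
      unfolding normal_density_def using \<tau> by (simp add: real_sqrt_mult divide_simps)
    moreover have "normal_density 0 (1 / sqrt (2 * l)) y = sqrt (2 * l) / sqrt (2 * pi) * exp (- (l * y\<^sup>2))"
      unfolding normal_density_def using l by (simp add: real_sqrt_mult real_sqrt_divide power_divide divide_simps)
    moreover have "exp c / (\<tau> * sqrt (2 * l)) * (sqrt (2 * l) / sqrt (2 * pi) * exp (- (l * y\<^sup>2)))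
        = 1 / (\<tau> * sqrt (2 * pi)) * exp (c - l * y\<^sup>2)"
      using \<tau> l by (simp add: exp_diff exp_minus divide_simps)
    ultimately show ?thesis
      by (simp only:) (intro mult_right_mono, auto)
  qed
  have "(\<integral>\<^sup>+\<omega>. ennreal (exp (c - l * (D \<omega>)\<^sup>2)) \<partial>M)
      = (\<integral>\<^sup>+y. ennreal (normal_density 0 \<tau> y) * ennreal (exp (c - l * y\<^sup>2)) \<partial>lborel)"
    by (rule distributed_nn_integral[OF D, symmetric]) measurable
  also have "\<dots> \<le> (\<integral>\<^sup>+y. ennreal (exp c / (\<tau> * sqrt (2 * l))) * ennreal (normal_density 0 (1 / sqrt (2 * l)) y) \<partial>lborel)"
    using \<tau> l * by (intro nn_integral_mono) (simp add: ennreal_mult[symmetric] ennreal_leI)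
  also have "\<dots> = ennreal (exp c / (\<tau> * sqrt (2 * l)))"
    using l by (simp add: nn_integral_cmult nn_integral_normal_density)
  finally show ?thesis .
qed

text \<open>
  Two random walks have to stay negative: one with steps \<open>A - Y k\<close> for the mean, and one with steps
  \<open>1 - l (Y (2 k - 1) - Y (2 k))\<^sup>2\<close> for the variance. Each fails with probability at most \<open>1 / 9\<close>.
\<close>

lemma (in prob_space) leader_path_positive_prob:
  fixes Y :: "nat \<Rightarrow> 'a \<Rightarrow> real"
  assumes indep: "indep_vars (\<lambda>_. borel) Y {1..}"
    and normal: "\<And>r. r \<ge> 1 \<Longrightarrow> distributed M lborel (Y r) (normal_density \<mu> \<sigma>)"
    and \<sigma>: "\<sigma> > 0" and N0: "N0 \<ge> 2"
  obtains A s where "s > 0" "prob {\<omega> \<in> space M. leader_path N0 A s (\<lambda>r. Y r \<omega>)} > 0"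
proof -
  have Y: "random_variable borel (Y r)" if "r \<ge> 1" for r
    using indep that unfolding indep_vars_def2 by auto
  \<comment> \<open>The constants \<open>A\<close> and \<open>l\<close> make the exponential moments of the steps of the two walks at most
    \<open>1 / 10\<close>; \<open>\<tau>\<close> is the standard deviation of a difference of two samples.\<close>
  define A where "A = ln (1 / 10) + \<mu> - \<sigma>\<^sup>2 / 2"
  define \<tau> where "\<tau> = sqrt (\<sigma>\<^sup>2 + \<sigma>\<^sup>2)"
  define l where "l = 50 * (exp 1 / \<tau>)\<^sup>2"
  have \<tau>: "\<tau> > 0"
    unfolding \<tau>_def using \<sigma> by (simp add: add_pos_pos)
  then have l: "l > 0"
    unfolding l_def by simp
  define W where "W k \<omega> = A - Y k \<omega>" for k \<omega>
  define D where "D k \<omega> = Y (2 * k - 1) \<omega> - Y (2 * k) \<omega>" for k \<omega>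
  define V where "V k \<omega> = 1 - l * (D k \<omega>)\<^sup>2" for k \<omega>
  have indep_W: "indep_vars (\<lambda>_. borel) W {1..}"
    unfolding W_def by (rule indep_vars_compose2[OF indep, of "\<lambda>_ y. A - y"]) measurable
  have W: "(\<integral>\<^sup>+\<omega>. ennreal (exp (W k \<omega>)) \<partial>M) \<le> ennreal (1 / 10)" if "k \<ge> 1" for k
    unfolding W_def nn_integral_exp_minus_normal[OF normal[OF that] \<sigma>] by (simp add: A_def)
  have indep_V: "indep_vars (\<lambda>_. borel) V {1..}"
  proof (rule indep_vars_of_blocks[OF indep])
    show "disjoint_family_on (\<lambda>k. {2 * k - 1, 2 * k}) {1 :: nat ..}"
      unfolding disjoint_family_on_def by auto
    show "V k \<in> block_algebra M Y {2 * k - 1, 2 * k} \<rightarrow>\<^sub>M borel" for k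
    proof -
      have [measurable]: "Y (2 * k - 1) \<in> borel_measurable (block_algebra M Y {2 * k - 1, 2 * k})"
        "Y (2 * k) \<in> borel_measurable (block_algebra M Y {2 * k - 1, 2 * k})"
        by (auto intro: measurable_block_algebra)
      show ?thesis
        unfolding V_def D_def by measurable
    qed
  qed auto
  have V: "(\<integral>\<^sup>+\<omega>. ennreal (exp (V k \<omega>)) \<partial>M) \<le> ennreal (1 / 10)" if k: "k \<ge> 1" for k
  proof -
    have "indep_vars (\<lambda>_. borel) Y (insert (2 * k - 1) {2 * k})"
      using k by (intro indep_vars_subset[OF indep]) auto
    then have "indep_var borel (Y (2 * k - 1)) borel (\<lambda>\<omega>. \<Sum>i \<in> {2 * k}. Y i \<omega>)"
      using k by (intro indep_vars_sum) auto
    then have "distributed M lborel (D k) (normal_density (\<mu> - \<mu>) \<tau>)"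
      unfolding D_def \<tau>_def using k \<sigma> by (intro diff_indep_normal normal) auto
    then have "distributed M lborel (D k) (normal_density 0 \<tau>)"
      by simp
    from nn_integral_exp_minus_square_normal[OF this \<tau> l, of 1]
    have "(\<integral>\<^sup>+\<omega>. ennreal (exp (V k \<omega>)) \<partial>M) \<le> ennreal (exp 1 / (\<tau> * sqrt (2 * l)))"
      unfolding V_def .
    also have "sqrt (2 * l) = 10 * (exp 1 / \<tau>)"
      unfolding l_def using \<tau> by (simp add: real_sqrt_mult)
    also have "exp 1 / (\<tau> * (10 * (exp 1 / \<tau>))) = 1 / 10"
      using \<tau> by simp
    finally show ?thesis .
  qed
  define s where "s = sqrt (1 / (4 * l))"
  have s: "s > 0" "4 * s\<^sup>2 = 1 / l"
    unfolding s_def using l by auto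
  define G where "G = {\<omega> \<in> space M. leader_path N0 A s (\<lambda>r. Y r \<omega>)}"
  define E1 where "E1 = {\<omega> \<in> space M. \<exists>n\<ge>1. 0 \<le> (\<Sum>k = 1..n. W k \<omega>)}"
  define E2 where "E2 = {\<omega> \<in> space M. \<exists>n\<ge>1. 0 \<le> (\<Sum>k = 1..n. V k \<omega>)}"
  have E1: "E1 \<in> events" "prob E1 \<le> 1 / 9"
    unfolding E1_def by (rule random_walk_stays_negative[OF indep_W W], assumption)+
  have E2: "E2 \<in> events" "prob E2 \<le> 1 / 9"
    unfolding E2_def by (rule random_walk_stays_negative[OF indep_V V], assumption)+
  have "Measurable.pred M (\<lambda>\<omega>. leader_path N0 A s (\<lambda>r. Y r \<omega>))"
    by (rule pred_leader_path) (use Y in auto)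
  then have G: "G \<in> events"
    unfolding G_def by measurable
  have "space M - (E1 \<union> E2) \<subseteq> G"
  proof
    fix \<omega> assume \<omega>: "\<omega> \<in> space M - (E1 \<union> E2)"
    have "leader_path N0 A s (\<lambda>r. Y r \<omega>)"
    proof (rule leader_path_of_partial_sums[OF N0])
      fix n :: nat assume "n \<ge> 1"
      with \<omega> have "(\<Sum>k = 1..n. W k \<omega>) < 0"
        unfolding E1_def by (simp add: not_le[symmetric])
      then show "real n * A < (\<Sum>r = 1..n. Y r \<omega>)"
        by (simp add: W_def sum_subtractf)
    next
      fix m :: nat assume "m \<ge> 1"
      with \<omega> have "(\<Sum>k = 1..m. V k \<omega>) < 0"
        unfolding E2_def by (simp add: not_le[symmetric])
      then have "real m < l * (\<Sum>k = 1..m. (D k \<omega>)\<^sup>2)"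
        by (simp add: V_def sum_subtractf sum_distrib_left)
      then show "real m * (4 * s\<^sup>2) < (\<Sum>k = 1..m. (Y (2 * k - 1) \<omega> - Y (2 * k) \<omega>)\<^sup>2)"
        unfolding s(2) using l by (simp add: D_def field_simps)
    qed (use s in auto)
    then show "\<omega> \<in> G"
      using \<omega> by (simp add: G_def)
  qed
  then have "prob (space M - (E1 \<union> E2)) \<le> prob G"
    using G by (intro finite_measure_mono) auto
  moreover have "prob (space M - (E1 \<union> E2)) = 1 - prob (E1 \<union> E2)"
    using E1 E2 by (intro prob_compl) auto
  moreover have "prob (E1 \<union> E2) \<le> prob E1 + prob E2"
    using E1 E2 by (intro measure_Un_le) auto
  ultimately have "prob G > 0"
    using E1 E2 by linarith
  with s(1) show ?thesis
    unfolding G_def by (rule that)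
qed

section \<open>Initial samples with a small variance\<close>

lemma normal_density_bounded_below:
  assumes "\<sigma> > 0" "a \<le> b"
  obtains \<kappa> where "\<kappa> > 0" "\<And>y. y \<in> {a..b} \<Longrightarrow> \<kappa> \<le> normal_density \<mu> \<sigma> y"
proof -
  have "continuous_on {a..b} (normal_density \<mu> \<sigma>)"
    unfolding normal_density_def using assms by (intro continuous_intros) auto
  then obtain y0 where y0: "\<forall>y \<in> {a..b}. normal_density \<mu> \<sigma> y0 \<le> normal_density \<mu> \<sigma> y"
    using continuous_attains_inf[of "{a..b}" "normal_density \<mu> \<sigma>"] assms by auto
  then show ?thesis
    using that[of "normal_density \<mu> \<sigma> y0"] normal_density_pos[OF assms(1)] by auto
qed

lemma (in prob_space) prob_interval_ge:
  assumes Y: "distributed M lborel Y (\<lambda>y. ennreal (f y))"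
    and f: "\<And>y. y \<in> {u..v} \<Longrightarrow> \<kappa> \<le> f y" and \<kappa>: "\<kappa> \<ge> 0" and uv: "u \<le> v"
  shows "\<kappa> * (v - u) \<le> prob (Y -` {u..v} \<inter> space M)"
proof -
  have "ennreal (\<kappa> * (v - u)) = (\<integral>\<^sup>+y. ennreal \<kappa> * indicator {u..v} y \<partial>lborel)"
    using uv \<kappa> by (simp add: nn_integral_cmult_indicator ennreal_mult)
  also have "\<dots> \<le> (\<integral>\<^sup>+y. ennreal (f y) * indicator {u..v} y \<partial>lborel)"
    using f by (intro nn_integral_mono) (auto split: split_indicator intro: ennreal_leI)
  also have "\<dots> = emeasure M (Y -` {u..v} \<inter> space M)"
    by (rule distributed_emeasure[OF Y, symmetric]) simp
  finally show ?thesis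
    by (simp add: emeasure_eq_measure)
qed

text \<open>
  A single box of side \<open>1 / (3 n)\<close> has probability of order \<open>n\<close> to the power \<open>-N0\<close>, which is too small by
  one factor. The common location of the samples is free, however: translating the box along a grid of mesh
  \<open>1 / n\<close> in an interval of length \<open>1\<close> gives \<open>n\<close> disjoint boxes, hence the exponent \<open>N0 - 1\<close>.
\<close>

lemma (in prob_space) poor_start_prob:
  fixes Y :: "nat \<Rightarrow> 'a \<Rightarrow> real"
  assumes indep: "indep_vars (\<lambda>_. borel) Y {1..}"
    and normal: "\<And>r. r \<ge> 1 \<Longrightarrow> distributed M lborel (Y r) (normal_density \<mu> \<sigma>)"
    and \<sigma>: "\<sigma> > 0" and N0: "N0 \<ge> 2"
  shows "\<exists>c>0. \<forall>n\<ge>1. c / real n ^ (N0 - 1) \<le> prob {\<omega> \<in> space M. poor_start N0 A (2 / real n) (\<lambda>r. Y r \<omega>)}"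
proof -
  have Y: "random_variable borel (Y r)" if "r \<ge> 1" for r
    using indep that unfolding indep_vars_def2 by auto
  obtain \<kappa> where \<kappa>: "\<kappa> > 0" "\<And>y. y \<in> {A - 2..A - 1} \<Longrightarrow> \<kappa> \<le> normal_density \<mu> \<sigma> y"
    using normal_density_bounded_below[OF \<sigma>, of "A - 2" "A - 1"] by auto
  show ?thesis
  proof (intro exI[of _ "(\<kappa> / 3) ^ N0"] conjI allI impI)
    fix n :: nat assume n: "n \<ge> 1"
    define h where "h = 1 / real n"
    have h: "h > 0" "real n * h = 1"
      unfolding h_def using n by auto
    define u where "u m = A - 2 + real m * h" for m :: nat
    define a where "a m r = (if r = 1 then u m else u m + 2 * h / 3)" for m and r :: nat
    define box where "box m = (\<Inter>r \<in> {1..N0}. Y r -` {a m r..a m r + h / 3} \<inter> space M)" for m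
    have grid: "A - 2 \<le> u m" "u m + h \<le> A - 1" if "m < n" for m
    proof -
      have "(real m + 1) * h \<le> real n * h"
        using that h by (intro mult_right_mono) auto
      then show "A - 2 \<le> u m" "u m + h \<le> A - 1"
        using h by (auto simp: u_def algebra_simps)
    qed
    have side: "\<kappa> / 3 * h \<le> prob (Y r -` {a m r..a m r + h / 3} \<inter> space M)" if "r \<in> {1..N0}" "m < n" for m r
    proof -
      have "\<kappa> * (a m r + h / 3 - a m r) \<le> prob (Y r -` {a m r..a m r + h / 3} \<inter> space M)"
      proof (rule prob_interval_ge[OF normal])
        fix y assume "y \<in> {a m r..a m r + h / 3}"
        then show "\<kappa> \<le> normal_density \<mu> \<sigma> y"
          using grid[OF that(2)] h by (intro \<kappa>(2)) (auto simp: a_def split: if_splits)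
      qed (use that \<kappa> h in auto)
      then show ?thesis
        by simp
    qed
    have prob_box: "(\<kappa> / 3 * h) ^ N0 \<le> prob (box m)" if "m < n" for m
    proof -
      have "(\<kappa> / 3 * h) ^ N0 = (\<Prod>r \<in> {1..N0}. \<kappa> / 3 * h)"
        by simp
      also have "\<dots> \<le> (\<Prod>r \<in> {1..N0}. prob (Y r -` {a m r..a m r + h / 3} \<inter> space M))"
        using side that \<kappa> h by (intro prod_mono) auto
      also have "\<dots> = prob (box m)"
        unfolding box_def using N0 by (intro indep_varsD[OF indep, symmetric]) auto
      finally show ?thesis .
    qed
    have box_event: "box m \<in> events" for m
      unfolding box_def using N0 Y by (intro sets.finite_INT measurable_sets) auto
    have disj: "disjoint_family_on box {..<n}"
      unfolding disjoint_family_on_def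
    proof (intro ballI impI equals0I)
      fix m m' \<omega> assume "m \<noteq> m'" and "\<omega> \<in> box m \<inter> box m'"
      moreover have "1 \<in> {1..N0}"
        using N0 by simp
      ultimately have "Y 1 \<omega> \<in> {a m 1..a m 1 + h / 3}" "Y 1 \<omega> \<in> {a m' 1..a m' 1 + h / 3}"
        unfolding box_def by blast+
      then have "u m \<le> Y 1 \<omega>" "Y 1 \<omega> \<le> u m + h / 3" "u m' \<le> Y 1 \<omega>" "Y 1 \<omega> \<le> u m' + h / 3"
        by (simp_all add: a_def)
      then have "\<bar>u m - u m'\<bar> \<le> h / 3"
        by linarith
      then have "\<bar>real m - real m'\<bar> * h \<le> (1 / 3) * h"
        using h by (simp add: u_def abs_mult left_diff_distrib[symmetric])
      then have "\<bar>real m - real m'\<bar> \<le> 1 / 3"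
        using h by (simp only: mult_le_cancel_right_pos)
      with \<open>m \<noteq> m'\<close> show False
        by linarith
    qed
    define P where "P = {\<omega> \<in> space M. poor_start N0 A (2 / real n) (\<lambda>r. Y r \<omega>)}"
    have "Measurable.pred M (\<lambda>\<omega>. poor_start N0 A (2 / real n) (\<lambda>r. Y r \<omega>))"
      by (rule pred_poor_start) (use Y in auto)
    then have P: "P \<in> events"
      unfolding P_def by measurable
    have sub: "box m \<subseteq> P" if "m < n" for m
    proof
      fix \<omega> assume "\<omega> \<in> box m"
      then have \<omega>: "\<omega> \<in> space M" "\<And>r. r \<in> {1..N0} \<Longrightarrow> a m r \<le> Y r \<omega> \<and> Y r \<omega> \<le> a m r + h / 3"
        unfolding box_def using N0 by auto
      have "poor_start N0 A (2 * h) (\<lambda>r. Y r \<omega>)"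
      proof (rule poor_start_of_box[OF N0])
        show "u m + h < A"
          using grid[OF that] by simp
        show "u m \<le> Y 1 \<omega>" "Y 1 \<omega> \<le> u m + h / 3"
          using \<omega>(2)[of 1] N0 by (auto simp: a_def)
        show "u m + 2 * h / 3 \<le> Y r \<omega> \<and> Y r \<omega> \<le> u m + h" if "r \<in> {2..N0}" for r
          using \<omega>(2)[of r] that by (auto simp: a_def)
      qed (rule h)
      then show "\<omega> \<in> P"
        using \<omega>(1) by (simp add: P_def h_def)
    qed
    \<comment> \<open>There are \<open>n\<close> boxes of probability at least \<open>(\<kappa> / (3 n)) ^ N0\<close> each.\<close>
    have "(\<kappa> / 3) ^ N0 / real n ^ (N0 - 1) = real n * (\<kappa> / 3 * h) ^ N0"
    proof -
      have "N0 = Suc (N0 - 1)"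
        using N0 by simp
      then have "real n ^ N0 = real n * real n ^ (N0 - 1)"
        by (metis power_Suc)
      then show ?thesis
        using n by (simp add: h_def power_mult_distrib power_divide)
    qed
    also have "\<dots> = (\<Sum>m < n. (\<kappa> / 3 * h) ^ N0)"
      by simp
    also have "\<dots> \<le> (\<Sum>m < n. prob (box m))"
      using prob_box by (intro sum_mono) auto
    also have "\<dots> = prob (\<Union>m < n. box m)"
      using box_event disj by (intro finite_measure_finite_Union[symmetric]) auto
    also have "\<dots> \<le> prob P"
      using P sub by (intro finite_measure_mono) auto
    finally show "(\<kappa> / 3) ^ N0 / real n ^ (N0 - 1) \<le> prob {\<omega> \<in> space M. poor_start N0 A (2 / real n) (\<lambda>r. Y r \<omega>)}"
      unfolding P_def .
  qed (use \<kappa> in simp)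
qed

section \<open>Probability of false selection\<close>

text \<open>
  The conditions on different designs are independent. The condition on \<open>j\<close> does not involve \<open>T\<close>, and each of
  the other \<open>K - 1\<close> designs contributes the exponent \<open>N0 - 1\<close>.
\<close>

lemma (in prob_space) trap_prob:
  fixes X :: "nat \<Rightarrow> nat \<Rightarrow> 'a \<Rightarrow> real"
  assumes indep: "indep_vars (\<lambda>_. borel) (\<lambda>(i, r). X i r) ({1..K} \<times> {1..})"
    and normal: "\<And>i r. i \<in> {1..K} \<Longrightarrow> r \<ge> 1 \<Longrightarrow> distributed M lborel (X i r) (normal_density (\<mu> i) (\<sigma> i))"
    and \<sigma>: "\<And>i. i \<in> {1..K} \<Longrightarrow> \<sigma> i > 0" and N0: "N0 \<ge> 2"
    and K: "K \<ge> 2" and tie: "tie_rule K tie" and j: "j \<in> {1..K}"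
  shows "\<exists>A. \<exists>s>0. \<exists>C>0. \<forall>T\<ge>1. C / real T ^ ((K - 1) * (N0 - 1))
      \<le> prob {\<omega> \<in> space M. trap tie K N0 j A s (1 / (4 * real K * real T)) (\<lambda>i r. X i r \<omega>)}"
proof -
  let ?Z = "\<lambda>(i, r). X i r"
  have design_indep: "indep_vars (\<lambda>_. borel) (X i) {1..}" if i: "i \<in> {1..K}" for i
  proof (rule indep_vars_of_blocks[OF indep])
    show "X i r \<in> block_algebra M ?Z {(i, r)} \<rightarrow>\<^sub>M borel" for r
      using measurable_block_algebra[of "(i, r)" "{(i, r)}" ?Z M] by simp
  qed (use i in \<open>auto simp: disjoint_family_on_def\<close>)
  obtain A s where s: "s > 0" and leader: "prob {\<omega> \<in> space M. leader_path N0 A s (\<lambda>r. X j r \<omega>)} > 0"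
    by (rule leader_path_positive_prob[OF design_indep[OF j] normal[OF j] \<sigma>[OF j] N0])
  define p where "p = prob {\<omega> \<in> space M. leader_path N0 A s (\<lambda>r. X j r \<omega>)}"
  have "\<forall>i \<in> {1..K}. \<exists>c>0. \<forall>n\<ge>1. c / real n ^ (N0 - 1)
      \<le> prob {\<omega> \<in> space M. poor_start N0 A (2 / real n) (\<lambda>r. X i r \<omega>)}"
    by (intro ballI poor_start_prob[OF design_indep normal \<sigma> N0])
  from bchoice[OF this] obtain c where c: "\<And>i. i \<in> {1..K} \<Longrightarrow> c i > 0"
    "\<And>i n. i \<in> {1..K} \<Longrightarrow> n \<ge> 1 \<Longrightarrow> c i / real n ^ (N0 - 1)
      \<le> prob {\<omega> \<in> space M. poor_start N0 A (2 / real n) (\<lambda>r. X i r \<omega>)}"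
    by blast
  \<comment> \<open>With \<open>n = q T\<close>, the standard deviation \<open>2 / n\<close> from \<open>poor_start_prob\<close> is at most
    \<open>\<delta> s = s / (4 K T)\<close>.\<close>
  define q where "q = nat \<lceil>8 * real K / s\<rceil>"
  have q: "8 * real K / s \<le> real q" "q \<ge> 1"
  proof -
    have "0 < 8 * real K / s"
      using K s by simp
    then show "8 * real K / s \<le> real q" "q \<ge> 1"
      unfolding q_def by linarith+
  qed
  define C where "C = p * (\<Prod>i \<in> {1..K} - {j}. c i / real q ^ (N0 - 1))"
  show ?thesis
  proof (rule exI[of _ A], rule exI[of _ s], rule conjI[OF s], rule exI[of _ C], intro conjI allI impI)
    show "C > 0"
      unfolding C_def using leader c(1) q by (intro mult_pos_pos prod_pos) (auto simp: p_def)
  next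
    fix T :: nat assume T: "T \<ge> 1"
    define \<delta> where "\<delta> = 1 / (4 * real K * real T)"
    define E where "E i = {\<omega> \<in> space M. if i = j then leader_path N0 A s (\<lambda>r. X i r \<omega>)
        else poor_start N0 A (\<delta> * s) (\<lambda>r. X i r \<omega>)}" for i
    have E_block: "E i \<in> sets (block_algebra M ?Z ({i} \<times> {1..}))" for i
    proof -
      let ?N = "block_algebra M ?Z ({i} \<times> {1..})"
      have X: "(\<lambda>\<omega>. X i r \<omega>) \<in> borel_measurable ?N" if "r \<ge> 1" for r
        using measurable_block_algebra[of "(i, r)" "{i} \<times> {1..}" ?Z M] that by simp
      have "{\<omega> \<in> space ?N. leader_path N0 A s (\<lambda>r. X i r \<omega>)} \<in> sets ?N"
        "{\<omega> \<in> space ?N. poor_start N0 A (\<delta> * s) (\<lambda>r. X i r \<omega>)} \<in> sets ?N"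
        using pred_leader_path[OF X] pred_poor_start[OF X] unfolding pred_def by auto
      then show ?thesis
        unfolding E_def by (cases "i = j") simp_all
    qed
    have E_event: "E i \<in> events" if "i \<in> {1..K}" for i
    proof -
      have "{i} \<times> {1..} \<subseteq> {1..K} \<times> {1 :: nat..}"
        using that by auto
      from sets_block_algebra_le[OF indep this] E_block[of i] show ?thesis
        by blast
    qed
    have poor: "c i / real q ^ (N0 - 1) * (1 / real T ^ (N0 - 1)) \<le> prob (E i)" if i: "i \<in> {1..K} - {j}" for i
    proof -
      have "8 * real K \<le> real q * s"
        using q s by (simp add: divide_simps)
      then have eps: "2 / real (q * T) \<le> \<delta> * s"
        unfolding \<delta>_def using K T q by (simp add: divide_simps mult_ac)
      have "c i / real q ^ (N0 - 1) * (1 / real T ^ (N0 - 1)) = c i / real (q * T) ^ (N0 - 1)"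
        by (simp add: power_mult_distrib)
      also have "\<dots> \<le> prob {\<omega> \<in> space M. poor_start N0 A (2 / real (q * T)) (\<lambda>r. X i r \<omega>)}"
        using i q T by (intro c(2)) (auto simp: Suc_le_eq)
      also have "\<dots> \<le> prob (E i)"
        using i eps E_event[of i] by (intro finite_measure_mono) (auto simp: E_def poor_start_def)
      finally show ?thesis .
    qed
    have "C / real T ^ ((K - 1) * (N0 - 1))
        = p * (\<Prod>i \<in> {1..K} - {j}. c i / real q ^ (N0 - 1) * (1 / real T ^ (N0 - 1)))"
      using j unfolding C_def prod.distrib by (simp add: power_mult[symmetric] mult.commute power_divide)
    also have "\<dots> \<le> prob (E j) * (\<Prod>i \<in> {1..K} - {j}. prob (E i))"
    proof (intro mult_mono prod_mono conjI)
      show "p \<le> prob (E j)"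
        by (simp add: p_def E_def)
      fix i assume i: "i \<in> {1..K} - {j}"
      show "0 \<le> c i / real q ^ (N0 - 1) * (1 / real T ^ (N0 - 1))"
        using c(1)[of i] i by simp
      show "c i / real q ^ (N0 - 1) * (1 / real T ^ (N0 - 1)) \<le> prob (E i)"
        by (rule poor[OF i])
    qed (use c(1) in \<open>auto intro!: prod_nonneg simp: less_imp_le\<close>)
    also have "\<dots> = (\<Prod>i \<in> {1..K}. prob (E i))"
      using j by (simp add: prod.remove)
    also have "\<dots> = prob (\<Inter>i \<in> {1..K}. E i)"
      using K E_block by (intro prob_blocks[OF indep, of "\<lambda>i. {i} \<times> {1..}", symmetric])
        (auto simp: disjoint_family_on_def)
    also have "(\<Inter>i \<in> {1..K}. E i) = {\<omega> \<in> space M. trap tie K N0 j A s \<delta> (\<lambda>i r. X i r \<omega>)}"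
    proof -
      have "trap tie K N0 j A s \<delta> x \<longleftrightarrow> (\<forall>i \<in> {1..K}. if i = j then leader_path N0 A s (x i)
          else poor_start N0 A (\<delta> * s) (x i))" for x
        using tie K N0 j s unfolding trap_def by auto
      note this[of "\<lambda>i r. X i r \<omega>" for \<omega>]
      then show ?thesis
        unfolding E_def using j by auto
    qed
    finally show "C / real T ^ ((K - 1) * (N0 - 1))
      \<le> prob {\<omega> \<in> space M. trap tie K N0 j A s (1 / (4 * real K * real T)) (\<lambda>i r. X i r \<omega>)}"
      unfolding \<delta>_def .
  qed
qed

lemma (in prob_space) PFS_ge:
  assumes out: "out \<in> M \<rightarrow>\<^sub>M count_space UNIV"
    and wrong: "\<And>\<omega>. \<omega> \<in> E \<Longrightarrow> \<omega> \<in> space M \<and> out \<omega> \<noteq> true_best K \<mu>"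
  shows "prob E \<le> PFS M K \<mu> out"
  unfolding PFS_def
proof (rule finite_measure_mono)
  have "Measurable.pred M (\<lambda>\<omega>. out \<omega> \<noteq> true_best K \<mu>)"
    by (rule measurable_compose[OF out, of "\<lambda>k. k \<noteq> true_best K \<mu>"]) simp
  then show "{\<omega> \<in> space M. out \<omega> \<noteq> true_best K \<mu>} \<in> events"
    by (simp add: pred_def)
qed (use wrong in auto)

lemma (in prob_space) prob_uniform_window:
  assumes U: "distr M lborel V = uniform_measure lborel {0<..<1 :: real}" "V \<in> borel_measurable M"
    and e: "0 < e" "e \<le> 1 / 2"
  shows "prob (V -` {e<..1 - e} \<inter> space M) = 1 - 2 * e"
proof -
  have "prob (V -` {e<..1 - e} \<inter> space M) = measure (distr M lborel V) {e<..1 - e}"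
    using U(2) by (intro measure_distr[symmetric]) auto
  also have "\<dots> = measure (uniform_measure lborel {0<..<1}) {e<..1 - e}"
    by (simp only: U(1))
  also have "\<dots> = measure lborel ({0<..<1} \<inter> {e<..1 - e}) / measure lborel {0<..<1 :: real}"
    by (rule measure_uniform_measure) auto
  also have "{0<..<1} \<inter> {e<..1 - e} = {e<..1 - e}"
    using e by auto
  finally show ?thesis
    using e by simp
qed

text \<open>
  Each window misses a set of probability \<open>1 / (2 T)\<close>, so Bernoulli's inequality bounds the \<open>T\<close>-fold product
  by \<open>1 - T / (2 T)\<close>.
\<close>

lemma (in prob_space) prob_uniform_windows:
  assumes indep: "indep_vars (\<lambda>_. borel) U UNIV"
    and U: "\<And>l. distr M lborel (U l) = uniform_measure lborel {0<..<1 :: real}"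
    and T: "T \<ge> 1"
  shows "1 / 2 \<le> prob {\<omega> \<in> space M. \<forall>l<T. U l \<omega> \<in> {1 / (4 * real T)<..1 - 1 / (4 * real T)}}"
proof -
  define e where "e = 1 / (4 * real T)"
  have e: "0 < e" "e \<le> 1 / 2" "real T * (2 * e) = 1 / 2"
    using T by (auto simp: e_def divide_simps)
  have "1 / 2 \<le> (1 - 2 * e) ^ T"
    using Bernoulli_inequality[of "- (2 * e)" T] e by simp
  also have "\<dots> = (\<Prod>l < T. prob (U l -` {e<..1 - e} \<inter> space M))"
    using indep e unfolding indep_vars_def2 by (simp add: prob_uniform_window[OF U])
  also have "\<dots> = prob (\<Inter>l < T. U l -` {e<..1 - e} \<inter> space M)"
    using T by (intro indep_varsD[OF indep, symmetric]) (auto simp: lessThan_empty_iff)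
  also have "(\<Inter>l < T. U l -` {e<..1 - e} \<inter> space M) = {\<omega> \<in> space M. \<forall>l<T. U l \<omega> \<in> {e<..1 - e}}"
    using T by (auto simp: lessThan_empty_iff)
  finally show ?thesis
    unfolding e_def .
qed

text \<open>
  The logarithm of a polynomial bound grows like \<open>ln T\<close>, which is negligible against \<open>T\<close>.
\<close>

lemma polynomial_lower_bound_rate:
  fixes f :: "nat \<Rightarrow> real"
  assumes C: "C > 0" and f: "\<And>T. T \<ge> T0 \<Longrightarrow> C / real T ^ p \<le> f T" "\<And>T. f T \<le> 1"
  shows "(\<forall>\<^sub>F T in sequentially. f T > 0) \<and> (\<lambda>T. - (1 / real T * ln (f T))) \<longlonglongrightarrow> 0"
proof
  have large: "\<forall>\<^sub>F T in sequentially. T \<ge> T0 \<and> T \<ge> 1"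
    by (intro eventually_conj eventually_ge_at_top)
  have pos: "0 < C / real T ^ p" "C / real T ^ p \<le> f T" if "T \<ge> T0 \<and> T \<ge> 1" for T
    using that C f(1) by auto
  show "\<forall>\<^sub>F T in sequentially. f T > 0"
    using large by eventually_elim (use pos in fastforce)
  have bounds: "0 \<le> - (1 / real T * ln (f T))"
    "- (1 / real T * ln (f T)) \<le> real p * (ln (real T) / real T) - ln C * inverse (real T)"
    if T: "T \<ge> T0 \<and> T \<ge> 1" for T
  proof -
    have "f T > 0"
      using pos[OF T] by linarith
    then have "ln (f T) \<le> 0"
      using f(2)[of T] by simp
    then show "0 \<le> - (1 / real T * ln (f T))"
      by (simp add: divide_nonpos_nonneg)
    have "ln C - real p * ln (real T) = ln (C / real T ^ p)"
      using T C by (simp add: ln_div ln_realpow)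
    also have "\<dots> \<le> ln (f T)"
      using pos[OF T] by simp
    finally have "- ln (f T) / real T \<le> (real p * ln (real T) - ln C) / real T"
      by (intro divide_right_mono) auto
    then show "- (1 / real T * ln (f T)) \<le> real p * (ln (real T) / real T) - ln C * inverse (real T)"
      by (simp add: divide_inverse algebra_simps)
  qed
  have "(\<lambda>T. real p * (ln (real T) / real T) - ln C * inverse (real T)) \<longlonglongrightarrow> real p * 0 - ln C * 0"
    by (intro tendsto_intros lim_ln_over_n lim_inverse_n)
  then have upper: "(\<lambda>T. real p * (ln (real T) / real T) - ln C * inverse (real T)) \<longlonglongrightarrow> 0"
    by simp
  show "(\<lambda>T. - (1 / real T * ln (f T))) \<longlonglongrightarrow> 0"
    by (rule tendsto_sandwich[OF _ _ tendsto_const upper])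
       (use large in \<open>eventually_elim, use bounds in auto\<close>)+
qed

lemma powr_minus_nat_product:
  assumes "T \<ge> 1" "K \<ge> 1" "N0 \<ge> 1"
  shows "real T powr (- ((real K - 1) * (real N0 - 1))) = 1 / real T ^ ((K - 1) * (N0 - 1))"
proof -
  have "(real K - 1) * (real N0 - 1) = real ((K - 1) * (N0 - 1))"
    using assms by (simp add: of_nat_diff)
  then show ?thesis
    using assms by (simp only: powr_minus powr_realpow) (simp add: powr_realpow divide_inverse)
qed

theorem theorem3p1:
  fixes M :: "'a measure"
    and X :: "nat \<Rightarrow> nat \<Rightarrow> 'a \<Rightarrow> real"
    and \<mu> \<sigma> :: "nat \<Rightarrow> real"
    and K N0 :: nat
    and tie :: "nat set \<Rightarrow> nat"
  assumes "prob_space M"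
    and "K \<ge> 2"
    and "inj_on \<mu> {1..K}"
    and "\<And>i. i \<in> {1..K} \<Longrightarrow> \<sigma> i > 0"
    and "prob_space.indep_vars M (\<lambda>_. borel) (\<lambda>(i, r). X i r) ({1..K} \<times> {1..})"
    and "\<And>i r. i \<in> {1..K} \<Longrightarrow> r \<ge> 1 \<Longrightarrow> distributed M lborel (X i r) (normal_density (\<mu> i) (\<sigma> i))"
    and "N0 \<ge> 2"
    and "tie_rule K tie"
  shows "(\<forall>\<Delta>::real. \<Delta> \<ge> 1 \<longrightarrow>
            (\<exists>C>0. \<forall>T::nat. T \<ge> K * N0 \<longrightarrow>
               PFS_OCBA M tie K \<mu> X N0 \<Delta> T \<ge> C * real T powr (- ((real K - 1) * (real N0 - 1)))))
       \<and> (\<exists>C>0. \<forall>T::nat. T \<ge> K * N0 \<longrightarrow>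
               PFS_OCBA_D M tie K \<mu> X N0 T \<ge> C * real T powr (- ((real K - 1) * (real N0 - 1))))
       \<and> (\<forall>U. uniform_randomization M K X U \<longrightarrow>
            (\<forall>\<^sub>F T in sequentially. PFS_OCBA_R M tie K \<mu> X U N0 T > 0) \<and>
            (\<lambda>T. - (1 / real T * ln (PFS_OCBA_R M tie K \<mu> X U N0 T))) \<longlonglongrightarrow> 0)"
proof -
  interpret prob_space M
    by fact
  obtain j where j: "j \<in> {1..K}" "j \<noteq> true_best K \<mu>"
  proof (cases "true_best K \<mu> = 1")
    case True
    then show ?thesis
      using that[of 2] assms(2) by simp
  next
    case False
    then show ?thesis
      using that[of 1] assms(2) by simp
  qed
  obtain A s C where s: "s > 0" and C: "C > 0" and trap_prob:
    "\<And>T. T \<ge> 1 \<Longrightarrow> C / real T ^ ((K - 1) * (N0 - 1))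
      \<le> prob {\<omega> \<in> space M. trap tie K N0 j A s (1 / (4 * real K * real T)) (\<lambda>i r. X i r \<omega>)}"
    using trap_prob[OF assms(5,6,4,7,2,8) j(1)] by blast
  define E where "E T = {\<omega> \<in> space M. trap tie K N0 j A s (1 / (4 * real K * real T)) (\<lambda>i r. X i r \<omega>)}" for T :: nat
  have trapped: "trap tie K N0 j A s (1 / (4 * real K * real T)) (\<lambda>i r. X i r \<omega>)" "\<omega> \<in> space M"
    if "\<omega> \<in> E T" for \<omega> T
    using that by (auto simp: E_def)
  have small: "1 / (4 * real K * real T) * real T < 1" for T :: nat
    using assms(2) by (cases "T = 0") (auto simp: field_simps)
  have T_pos: "T \<ge> 1" if "T \<ge> K * N0" for T
    using that assms(2,7) by (metis One_nat_def Suc_leI le_trans mult_pos_pos not_numeral_le_zero zero_less_iff_neq_zero)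
  have bound: "C * real T powr (- ((real K - 1) * (real N0 - 1))) \<le> prob (E T)" if "T \<ge> K * N0" for T
    using trap_prob[OF T_pos[OF that]] powr_minus_nat_product[OF T_pos[OF that], of K N0] assms(2,7)
    by (simp add: E_def)
  have X: "(\<lambda>\<omega>. X i r \<omega>) \<in> borel_measurable M" if "i \<in> {1..K}" "r \<ge> 1" for i r
    using assms(5) that unfolding indep_vars_def2 by auto
  interpret run: measurable_run M tie K "\<lambda>\<omega> i r. X i r \<omega>"
    by unfold_locales (use assms(2,8) X in auto)

  have "\<exists>C>0. \<forall>T \<ge> K * N0. PFS_OCBA M tie K \<mu> X N0 \<Delta> T \<ge> C * real T powr (- ((real K - 1) * (real N0 - 1)))"
    if \<Delta>: "\<Delta> \<ge> 1" for \<Delta>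
  proof (intro exI[of _ C] conjI C allI impI)
    fix T assume T: "T \<ge> K * N0"
    have "prob (E T) \<le> PFS_OCBA M tie K \<mu> X N0 \<Delta> T"
      unfolding PFS_OCBA_def
    proof (rule PFS_ge[OF run.ocba_output_measurable])
      fix \<omega> assume \<omega>: "\<omega> \<in> E T"
      show "\<omega> \<in> space M \<and> ocba_output tie K N0 \<Delta> T (\<lambda>i r. X i r \<omega>) \<noteq> true_best K \<mu>"
        using trap.ocba_output_leader[OF trapped(1)[OF \<omega>] small \<Delta>] trapped(2)[OF \<omega>] j(2) by simp
    qed
    with bound[OF T] show "C * real T powr (- ((real K - 1) * (real N0 - 1))) \<le> PFS_OCBA M tie K \<mu> X N0 \<Delta> T"
      by linarith
  qed
  moreover
  have "\<exists>C>0. \<forall>T \<ge> K * N0. PFS_OCBA_D M tie K \<mu> X N0 T \<ge> C * real T powr (- ((real K - 1) * (real N0 - 1)))"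
  proof (intro exI[of _ C] conjI C allI impI)
    fix T assume T: "T \<ge> K * N0"
    have "prob (E T) \<le> PFS_OCBA_D M tie K \<mu> X N0 T"
      unfolding PFS_OCBA_D_def
    proof (rule PFS_ge[OF run.ocba_d_output_measurable])
      fix \<omega> assume \<omega>: "\<omega> \<in> E T"
      show "\<omega> \<in> space M \<and> ocba_d_output tie K N0 T (\<lambda>i r. X i r \<omega>) \<noteq> true_best K \<mu>"
        using trap.ocba_d_output_leader[OF trapped(1)[OF \<omega>] T small] trapped(2)[OF \<omega>] j(2) by simp
    qed
    with bound[OF T] show "C * real T powr (- ((real K - 1) * (real N0 - 1))) \<le> PFS_OCBA_D M tie K \<mu> X N0 T"
      by linarith
  qed
  moreover
  have "(\<forall>\<^sub>F T in sequentially. PFS_OCBA_R M tie K \<mu> X U N0 T > 0) \<and>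
      (\<lambda>T. - (1 / real T * ln (PFS_OCBA_R M tie K \<mu> X U N0 T))) \<longlonglongrightarrow> 0"
    if "uniform_randomization M K X U" for U
  proof (rule polynomial_lower_bound_rate)
    let ?Z = "case_sum (\<lambda>(i, r). X i r) U"
    let ?BX = "Inl ` ({1..K} \<times> {1..}) :: (nat \<times> nat + nat) set"
    let ?BU = "range Inr :: (nat \<times> nat + nat) set"
    have U: "distr M lborel (U l) = uniform_measure lborel {0<..<1}" for l
      using that unfolding uniform_randomization_def by blast
    have indep: "indep_vars (\<lambda>_. borel) ?Z (({1..K} \<times> {1..}) <+> UNIV)"
      using that unfolding uniform_randomization_def by blast
    have indep_U: "indep_vars (\<lambda>_. borel) U UNIV"
    proof (rule indep_vars_of_blocks[OF indep])
      show "U l \<in> block_algebra M ?Z {Inr l} \<rightarrow>\<^sub>M borel" for l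
        using measurable_block_algebra[of "Inr l" "{Inr l}" ?Z M] by simp
    qed (auto simp: disjoint_family_on_def)
    have U_meas: "U l \<in> borel_measurable M" for l
      using indep_U unfolding indep_vars_def2 by blast
    show "C / 2 > 0"
      using C by simp
    show "PFS_OCBA_R M tie K \<mu> X U N0 T \<le> 1" for T
      unfolding PFS_OCBA_R_def PFS_def by simp
    fix T assume T: "T \<ge> K * N0"
    define V where "V = {\<omega> \<in> space M. \<forall>l<T. U l \<omega> \<in> {1 / (4 * real T)<..1 - 1 / (4 * real T)}}"
    have "E T \<in> sets (block_algebra M ?Z ?BX)"
    proof -
      let ?N = "block_algebra M ?Z ?BX"
      have X_block: "(\<lambda>\<omega>. X i r \<omega>) \<in> borel_measurable ?N" if "i \<in> {1..K}" "r \<ge> 1" for i r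
        using measurable_block_algebra[of "Inl (i, r)" ?BX ?Z M] that by auto
      have [measurable]: "Measurable.pred ?N (\<lambda>\<omega>. leader_path N0 A s (\<lambda>r. X j r \<omega>))"
        by (rule pred_leader_path) (rule X_block[OF j(1)])
      have [measurable]: "Measurable.pred ?N (\<lambda>\<omega>. poor_start N0 A e (\<lambda>r. X i r \<omega>))" if "i \<in> {1..K} - {j}" for i e
        by (rule pred_poor_start) (use X_block that in auto)
      have "E T = {\<omega> \<in> space ?N. leader_path N0 A s (\<lambda>r. X j r \<omega>) \<and>
          (\<forall>i \<in> {1..K} - {j}. poor_start N0 A (1 / (4 * real K * real T) * s) (\<lambda>r. X i r \<omega>))}"
        unfolding E_def trap_def using assms(2,7,8) j(1) s by auto
      also have "\<dots> \<in> sets ?N"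
        by measurable
      finally show ?thesis .
    qed
    moreover have "V \<in> sets (block_algebra M ?Z ?BU)"
    proof -
      have [measurable]: "U l \<in> borel_measurable (block_algebra M ?Z ?BU)" for l
        using measurable_block_algebra[of "Inr l" ?BU ?Z M] by simp
      have "{\<omega> \<in> space (block_algebra M ?Z ?BU). \<forall>l<T. U l \<omega> \<in> {1 / (4 * real T)<..1 - 1 / (4 * real T)}}
          \<in> sets (block_algebra M ?Z ?BU)"
        by measurable
      then show ?thesis
        unfolding V_def space_block_algebra .
    qed
    ultimately have "prob (E T \<inter> V) = prob (E T) * prob V"
      by (rule prob_two_blocks[OF indep, rotated 3]) auto
    moreover have "1 / 2 \<le> prob V"
      unfolding V_def by (rule prob_uniform_windows[OF indep_U U T_pos[OF T]])
    moreover have "C / real T ^ ((K - 1) * (N0 - 1)) \<le> prob (E T)"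
      using trap_prob[OF T_pos[OF T]] by (simp add: E_def)
    ultimately have "C / real T ^ ((K - 1) * (N0 - 1)) * (1 / 2) \<le> prob (E T \<inter> V)"
      by (simp only:) (intro mult_mono, auto)
    also have "\<dots> \<le> PFS_OCBA_R M tie K \<mu> X U N0 T"
      unfolding PFS_OCBA_R_def
    proof (rule PFS_ge[OF run.ocba_r_output_measurable])
      fix \<omega> assume \<omega>: "\<omega> \<in> E T \<inter> V"
      have "real K * (1 / (4 * real K * real T)) = 1 / (4 * real T)"
        using assms(2) by simp
      then have "real K * (1 / (4 * real K * real T)) < U l \<omega> \<and> U l \<omega> \<le> 1 - real K * (1 / (4 * real K * real T))"
        if "l < T" for l
        using \<omega> that by (simp add: V_def)
      then have "ocba_r_output tie K N0 T (\<lambda>i r. X i r \<omega>) (\<lambda>l. U l \<omega>) = j"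
        using \<omega> T trap.ocba_r_output_leader[OF trapped(1), of \<omega> T T "\<lambda>l. U l \<omega>"] by blast
      then show "\<omega> \<in> space M \<and> ocba_r_output tie K N0 T (\<lambda>i r. X i r \<omega>) (\<lambda>l. U l \<omega>) \<noteq> true_best K \<mu>"
        using \<omega> trapped(2) j(2) by blast
    qed (rule U_meas)
    finally show "C / 2 / real T ^ ((K - 1) * (N0 - 1)) \<le> PFS_OCBA_R M tie K \<mu> X U N0 T"
      by simp
  qed
  ultimately show ?thesis
    by blast
qed

end
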